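(* Let $T$ and $T'$ be commuting contractions on a complex Hilbert space $\mathcal{H}$ such that $T$ is Harnack dominated by $T'$. Then $\mathcal{N}(S_T)=\mathcal{N}(S_{T'})$ (hence $\overline{\mathcal{R}(S_T)}=\overline{\mathcal{R}(S_{T'})}$), and the canonical triangulations of $T$ and $T'$, i.e. their matrix representations with respect to $\mathcal{H}=\mathcal{N}(S_T)\oplus\overline{\mathcal{R}(S_T)}$, have the form $$T=\begin{pmatrix} Q & R\\ 0 & W\end{pmatrix},\qquad T'=\begin{pmatrix} Q' & R'\\ 0 & W\end{pmatrix},$$ with the same operator $W$, where $Q,Q'$ are of class $C_{0\cdot}$ on $\mathcal{N}(S_T)=\mathcal{N}(S_{T'})$ with $QQ'=Q'Q$ and $Q$ Harnack dominated by $Q'$, and $W$ is of class $C_{1\cdot}$ on $\overline{\mathcal{R}(S_T)}$, and $QR'-Q'R=(R'-R)W$. Moreover, $S_T=S_T^2$ if and only if $S_{T'}=S_{T'}^2$. In this case $S_T=S_{T'}$, $W$ is an isometry and $R=R'=0$; in addition, in this case, $T$ and $T'$ are Harnack equivalent if and only if $Q'$ is Harnack dominated by $Q$.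
   Context: A contraction is a bounded linear operator of norm at most $1$; $\mathcal{N}(\cdot)$ and $\mathcal{R}(\cdot)$ denote kernel and range. For a self-adjoint comparison, $A\le B$ means $B-A$ is positive semidefinite; $\operatorname{Re}A=\frac12(A+A^* )$. Harnack domination: for contractions $T,T'$ on the same Hilbert space, $T$ is Harnack dominated by $T'$ if there is a constant $c\ge 1$ such that $\operatorname{Re}p(T)\le c\,\operatorname{Re}p(T')$ for every analytic polynomial $p$ with $\operatorname{Re}p(z)\ge 0$ for $|z|\le 1$. $T$ and $T'$ are Harnack equivalent if each is Harnack dominated by the other. Asymptotic limit: for a contraction $T$, $S_T$ is the strong limit of the sequence $\{T^{*n}T^n\}_{n}$. A contraction $T$ is of class $C_{0\cdot}$ if $T^nh\to 0$ for every $h$ (equivalently $S_T=0$), and of class $C_{1\cdot}$ if $T^nh\not\to 0$ for every nonzero $h$. Canonical triangulation of $T$: the matrix representation of $T$ with respect to $\mathcal{H}=\mathcal{N}(S_T)\oplus\overline{\mathcal{R}(S_T)}$ (upper triangular since $\mathcal{N}(S_T)$ is $T$-invariant). *)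

theory Defs
  imports "HOL-Analysis.Analysis" "HOL-Computational_Algebra.Polynomial"
begin

text \<open>
  A complex Hilbert space is a type of the class below; the topology, norm and completeness are
  those of \<^class>\<open>banach\<close>. The inner product is linear in its first argument.
\<close>

class complex_hilbert = banach +
  fixes scaleC :: "complex \<Rightarrow> 'a \<Rightarrow> 'a" (infixr "*\<^sub>C" 75)
    and cinner :: "'a \<Rightarrow> 'a \<Rightarrow> complex"
  assumes scaleC_add_right: "a *\<^sub>C (x + y) = a *\<^sub>C x + a *\<^sub>C y"
    and scaleC_add_left: "(a + b) *\<^sub>C x = a *\<^sub>C x + b *\<^sub>C x"
    and scaleC_scaleC: "a *\<^sub>C (b *\<^sub>C x) = (a * b) *\<^sub>C x"
    and scaleC_of_real: "complex_of_real r *\<^sub>C x = r *\<^sub>R x"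
    and cinner_commute: "cinner x y = cnj (cinner y x)"
    and cinner_add_left: "cinner (x + y) z = cinner x z + cinner y z"
    and cinner_scaleC_left: "cinner (a *\<^sub>C x) y = a * cinner x y"
    and cinner_self_nonneg: "0 \<le> Re (cinner x x)"
    and cinner_self_eq_0_iff: "cinner x x = 0 \<longleftrightarrow> x = 0"
    and norm_eq_sqrt_cinner: "norm x = sqrt (Re (cinner x x))"

instantiation complex :: complex_hilbert
begin

definition scaleC_complex :: "complex \<Rightarrow> complex \<Rightarrow> complex" where
  "scaleC_complex a x = a * x"

definition cinner_complex :: "complex \<Rightarrow> complex \<Rightarrow> complex" where
  "cinner_complex x y = x * cnj y"

instance
  by standard
    (auto simp: scaleC_complex_def cinner_complex_def algebra_simps scaleR_conv_of_real
      cmod_def power2_eq_square)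

end

definition closed_csubspace :: "'a::complex_hilbert set \<Rightarrow> bool" where
  "closed_csubspace M \<longleftrightarrow>
     closed M \<and> 0 \<in> M \<and> (\<forall>x\<in>M. \<forall>y\<in>M. x + y \<in> M) \<and> (\<forall>a. \<forall>x\<in>M. a *\<^sub>C x \<in> M)"

text \<open>
  The diagonal blocks of a triangulation are operators on closed subspaces, so operator notions
  are relative to subspaces M, N of the ambient type: an operator from M to N is a function on
  the whole type of which only the values on M matter. An operator on the whole space is the
  case M = N = UNIV.
\<close>

definition bounded_clinear_on ::
    "'a::complex_hilbert set \<Rightarrow> 'a set \<Rightarrow> ('a \<Rightarrow> 'a) \<Rightarrow> bool" where
  "bounded_clinear_on M N A \<longleftrightarrow>
     (\<forall>x\<in>M. A x \<in> N) \<and>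
     (\<forall>x\<in>M. \<forall>y\<in>M. A (x + y) = A x + A y) \<and>
     (\<forall>a. \<forall>x\<in>M. A (a *\<^sub>C x) = a *\<^sub>C A x) \<and>
     (\<exists>K. \<forall>x\<in>M. norm (A x) \<le> K * norm x)"

definition contraction_on :: "'a::complex_hilbert set \<Rightarrow> ('a \<Rightarrow> 'a) \<Rightarrow> bool" where
  "contraction_on M T \<longleftrightarrow> bounded_clinear_on M M T \<and> (\<forall>x\<in>M. norm (T x) \<le> norm x)"

definition isometry_on :: "'a::complex_hilbert set \<Rightarrow> ('a \<Rightarrow> 'a) \<Rightarrow> bool" where
  "isometry_on M T \<longleftrightarrow> bounded_clinear_on M M T \<and> (\<forall>x\<in>M. norm (T x) = norm x)"

definition adj_on :: "'a::complex_hilbert set \<Rightarrow> ('a \<Rightarrow> 'a) \<Rightarrow> 'a \<Rightarrow> 'a" where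
  "adj_on M A y = (THE z. z \<in> M \<and> (\<forall>x\<in>M. cinner (A x) y = cinner x z))"

definition re_op_on :: "'a::complex_hilbert set \<Rightarrow> ('a \<Rightarrow> 'a) \<Rightarrow> 'a \<Rightarrow> 'a" where
  "re_op_on M A x = (1/2) *\<^sub>R (A x + adj_on M A x)"

definition psd_on :: "'a::complex_hilbert set \<Rightarrow> ('a \<Rightarrow> 'a) \<Rightarrow> bool" where
  "psd_on M A \<longleftrightarrow> (\<forall>x\<in>M. cinner (A x) x \<in> \<real> \<and> 0 \<le> Re (cinner (A x) x))"

definition op_le_on :: "'a::complex_hilbert set \<Rightarrow> ('a \<Rightarrow> 'a) \<Rightarrow> ('a \<Rightarrow> 'a) \<Rightarrow> bool" where
  "op_le_on M A B \<longleftrightarrow> psd_on M (\<lambda>x. B x - A x)"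

definition poly_op :: "complex poly \<Rightarrow> ('a::complex_hilbert \<Rightarrow> 'a) \<Rightarrow> 'a \<Rightarrow> 'a" where
  "poly_op p T x = (\<Sum>i\<le>degree p. coeff p i *\<^sub>C (T ^^ i) x)"

definition harnack_dominated_on ::
    "'a::complex_hilbert set \<Rightarrow> ('a \<Rightarrow> 'a) \<Rightarrow> ('a \<Rightarrow> 'a) \<Rightarrow> bool" where
  "harnack_dominated_on M T T' \<longleftrightarrow>
     contraction_on M T \<and> contraction_on M T' \<and>
     (\<exists>c::real. c \<ge> 1 \<and>
        (\<forall>p. (\<forall>z. cmod z \<le> 1 \<longrightarrow> 0 \<le> Re (poly p z)) \<longrightarrow>
             op_le_on M (re_op_on M (poly_op p T)) (\<lambda>x. c *\<^sub>R re_op_on M (poly_op p T') x)))"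

definition harnack_equivalent_on ::
    "'a::complex_hilbert set \<Rightarrow> ('a \<Rightarrow> 'a) \<Rightarrow> ('a \<Rightarrow> 'a) \<Rightarrow> bool" where
  "harnack_equivalent_on M T T' \<longleftrightarrow> harnack_dominated_on M T T' \<and> harnack_dominated_on M T' T"

definition class_C0 :: "'a::complex_hilbert set \<Rightarrow> ('a \<Rightarrow> 'a) \<Rightarrow> bool" where
  "class_C0 M T \<longleftrightarrow> contraction_on M T \<and> (\<forall>h\<in>M. (\<lambda>n. (T ^^ n) h) \<longlonglongrightarrow> 0)"

definition class_C1 :: "'a::complex_hilbert set \<Rightarrow> ('a \<Rightarrow> 'a) \<Rightarrow> bool" where
  "class_C1 M T \<longleftrightarrow>
     contraction_on M T \<and> (\<forall>h\<in>M. h \<noteq> 0 \<longrightarrow> \<not> (\<lambda>n. (T ^^ n) h) \<longlonglongrightarrow> 0)"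

text \<open>
  For a contraction the limit exists at every vector, since the powers involved form a decreasing
  sequence of positive operators.
\<close>

definition asymp_limit :: "('a::complex_hilbert \<Rightarrow> 'a) \<Rightarrow> 'a \<Rightarrow> 'a" where
  "asymp_limit T x = lim (\<lambda>n. (adj_on UNIV T ^^ n) ((T ^^ n) x))"

definition null_space :: "('a::complex_hilbert \<Rightarrow> 'a) \<Rightarrow> 'a set" where
  "null_space A = {x. A x = 0}"

definition orthogonal_decomp :: "'a::complex_hilbert set \<Rightarrow> 'a set \<Rightarrow> bool" where
  "orthogonal_decomp M N \<longleftrightarrow>
     closed_csubspace M \<and> closed_csubspace N \<and>
     (\<forall>x\<in>M. \<forall>y\<in>N. cinner x y = 0) \<and> (\<forall>h. \<exists>x\<in>M. \<exists>y\<in>N. h = x + y)"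

text \<open>
  T has the block matrix with rows (A, B) and (C, D) with respect to the orthogonal sum of
  M and N. The blocks are determined by T on their respective domains.
\<close>

definition block_matrix :: "'a::complex_hilbert set \<Rightarrow> 'a set \<Rightarrow> ('a \<Rightarrow> 'a) \<Rightarrow>
    ('a \<Rightarrow> 'a) \<Rightarrow> ('a \<Rightarrow> 'a) \<Rightarrow> ('a \<Rightarrow> 'a) \<Rightarrow> ('a \<Rightarrow> 'a) \<Rightarrow> bool" where
  "block_matrix M N T A B C D \<longleftrightarrow>
     orthogonal_decomp M N \<and>
     bounded_clinear_on M M A \<and> bounded_clinear_on N M B \<and>
     bounded_clinear_on M N C \<and> bounded_clinear_on N N D \<and>
     (\<forall>x\<in>M. \<forall>y\<in>N. T (x + y) = (A x + B y) + (C x + D y))"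

end

theory Submission
  imports Defs
begin

text \<open>
  Harnack domination with constant c upgrades from polynomials to the Toeplitz forms of the powers:
  testing against rotated Fejer kernels and averaging over roots of unity gives, for all vectors
  h(0), ..., h(n-1), the inequality between the forms with entries \<langle>T^(i-j) h(i), h(j)\<rangle>.
  The choice h = (T'x, -x) yields |T'x - Tx|^2 \<le> c (|x|^2 - |T'x|^2), whence
  T'^k (T' - T) x \<rightarrow> 0 because T and T' commute; so T and T' agree modulo the null space of the
  asymptotic limit of T' and have the same corner W. The choice h(i) = T^(N-i) x bounds |T^N x|^2 by
  a Cesaro mean of the norms |T'^l x|, so T'^n x \<rightarrow> 0 implies T^n x \<rightarrow> 0. Conversely
  lim |T'^k x| is unchanged when x is replaced by T^n x, hence vanishes if T^n x \<rightarrow> 0.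
  The asymptotic limit is idempotent exactly when W is isometric, and then R = R' = 0
  because |Ry|^2 + |Wy|^2 = |Ty|^2 \<le> |y|^2 = |Wy|^2, and likewise for R'.
\<close>

section \<open>Complex Hilbert spaces\<close>

text \<open>Domination compares one vector under one scalar polynomial, whereas a Toeplitz form
  couples n vectors. The link is the vector sum of \<zeta>^i h(i): its quadratic forms contain every
  pair (i, j) with phase \<zeta>^(i-j), and a kernel rotated by the conjugate of \<zeta> matches
  frequency l with the pairs i - j = l. The form that is wanted belongs to the Herglotz kernel (1 +
  z)/(1 - z) = 1 + 2z + 2z^2 + ..., the source of the weights 1, 2, 2, ...; it is no polynomial and
  its truncations lose positivity, so Fejer kernels of order K approximate it, and K tends to
  infinity while n stays fixed. The smallness of (T' - T)x is seen only along orbits of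
  \<open>T'\<close>. It therefore carries null orbits from \<open>T\<close> to \<open>T'\<close> but
  not back, which is why the reverse inclusion needs its own choice of vectors and a Cesaro
  mean.\<close>

lemma cinner_add_right: "cinner x (y + z) = cinner x y + cinner (x::'a::complex_hilbert) z"
  by (metis cinner_add_left cinner_commute complex_cnj_add)

lemma cinner_scaleC_right: "cinner x (a *\<^sub>C y) = cnj a * cinner (x::'a::complex_hilbert) y"
  by (metis cinner_commute cinner_scaleC_left complex_cnj_mult)

lemma cinner_scaleR_left: "cinner (r *\<^sub>R x) y = of_real r * cinner (x::'a::complex_hilbert) y"
  by (metis cinner_scaleC_left scaleC_of_real)

lemma cinner_scaleR_right: "cinner x (r *\<^sub>R y) = of_real r * cinner (x::'a::complex_hilbert) y"
  by (metis cinner_scaleC_right scaleC_of_real complex_cnj_complex_of_real)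

lemma cinner_zero_left [simp]: "cinner 0 (y::'a::complex_hilbert) = 0"
  using cinner_scaleR_left[of 0 0 y] by simp

lemma cinner_zero_right [simp]: "cinner (y::'a::complex_hilbert) 0 = 0"
  using cinner_scaleR_right[of y 0 0] by simp

lemma cinner_minus_left: "cinner (- x) y = - cinner (x::'a::complex_hilbert) y"
  using cinner_scaleR_left[of "-1" x y] by simp

lemma cinner_minus_right: "cinner x (- y) = - cinner (x::'a::complex_hilbert) y"
  using cinner_scaleR_right[of x "-1" y] by simp

lemma cinner_diff_left: "cinner (x - y) z = cinner x z - cinner (y::'a::complex_hilbert) z"
  using cinner_add_left[of x "- y" z] by (simp add: cinner_minus_left)

lemma cinner_diff_right: "cinner z (x - y) = cinner z x - cinner (z::'a::complex_hilbert) y"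
  using cinner_add_right[of z x "- y"] by (simp add: cinner_minus_right)

lemma cinner_sum_left: "cinner (sum f A) (z::'a::complex_hilbert) = (\<Sum>i\<in>A. cinner (f i) z)"
  by (induction A rule: infinite_finite_induct) (auto simp: cinner_add_left)

lemma cinner_sum_right: "cinner (z::'a::complex_hilbert) (sum f A) = (\<Sum>i\<in>A. cinner z (f i))"
  by (induction A rule: infinite_finite_induct) (auto simp: cinner_add_right)

lemma Re_cinner_commute: "Re (cinner y x) = Re (cinner x (y::'a::complex_hilbert))"
  by (subst cinner_commute) simp

lemma cinner_eq_0_commute: "cinner y x = 0 \<longleftrightarrow> cinner x (y::'a::complex_hilbert) = 0"
  by (metis cinner_commute complex_cnj_zero)

lemma cinner_self: "cinner x x = of_real ((norm (x::'a::complex_hilbert))\<^sup>2)"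
proof -
  have "Im (cinner x x) = 0"
    using cinner_commute[of x x] by (simp add: complex_eq_iff)
  then show ?thesis
    by (simp add: complex_eq_iff norm_eq_sqrt_cinner cinner_self_nonneg)
qed

lemma Re_cinner_self: "Re (cinner x x) = (norm (x::'a::complex_hilbert))\<^sup>2"
  by (simp add: cinner_self)

lemma norm_add_sq: "(norm (x + y))\<^sup>2 = (norm x)\<^sup>2 + (norm y)\<^sup>2 + 2 * Re (cinner x (y::'a::complex_hilbert))"
  by (simp add: Re_cinner_self[symmetric] cinner_add_left cinner_add_right Re_cinner_commute[of y x])

lemma norm_diff_sq: "(norm (x - y))\<^sup>2 = (norm x)\<^sup>2 + (norm y)\<^sup>2 - 2 * Re (cinner x (y::'a::complex_hilbert))"
  using norm_add_sq[of x "- y"] by (simp add: cinner_minus_right)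

lemma scaleC_zero_right [simp]: "a *\<^sub>C (0::'a::complex_hilbert) = 0"
  using scaleC_add_right[of a 0 0] by simp

lemma scaleC_one [simp]: "1 *\<^sub>C (x::'a::complex_hilbert) = x"
  using scaleC_of_real[of 1 x] by simp

lemma scaleC_zero_left [simp]: "0 *\<^sub>C (x::'a::complex_hilbert) = 0"
  using scaleC_of_real[of 0 x] by simp

lemma scaleC_minus_one [simp]: "(- 1) *\<^sub>C (x::'a::complex_hilbert) = - x"
  using scaleC_of_real[of "-1" x] by simp

lemma norm_scaleC: "norm (a *\<^sub>C (x::'a::complex_hilbert)) = cmod a * norm x"
proof -
  have "cinner (a *\<^sub>C x) (a *\<^sub>C x) = (a * cnj a) * cinner x x"
    by (simp add: cinner_scaleC_left cinner_scaleC_right)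
  also have "\<dots> = of_real ((cmod a)\<^sup>2 * (norm x)\<^sup>2)"
    unfolding cinner_self of_real_mult complex_norm_square[symmetric] by simp
  finally have "cinner (a *\<^sub>C x) (a *\<^sub>C x) = of_real ((cmod a)\<^sup>2 * (norm x)\<^sup>2)" .
  then have "(norm (a *\<^sub>C x))\<^sup>2 = (cmod a * norm x)\<^sup>2"
    unfolding cinner_self power_mult_distrib of_real_eq_iff .
  then show ?thesis
    by simp
qed

text \<open>The triangle inequality comes with the class \<open>banach\<close>, so the
  Cauchy-Schwarz inequality is derived from it instead of the other way round.\<close>

lemma Re_cinner_le: "Re (cinner x y) \<le> norm x * norm (y::'a::complex_hilbert)"
proof -
  have "(norm (x + y))\<^sup>2 \<le> (norm x + norm y)\<^sup>2"
    by (intro power_mono norm_triangle_ineq) auto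
  then show ?thesis
    unfolding norm_add_sq by (simp add: power2_sum)
qed

lemma cmod_cinner_le: "cmod (cinner x y) \<le> norm x * norm (y::'a::complex_hilbert)"
proof (cases "cinner x y = 0")
  case False
  \<comment> \<open>The unimodular factor \<open>a\<close> rotates \<open>cinner x y\<close> onto
    the nonnegative real axis, where the bound on real parts is a bound on the modulus.\<close>
  define a where "a = cnj (cinner x y) / of_real (cmod (cinner x y))"
  have a: "cmod a = 1"
    using False by (simp add: a_def norm_divide)
  have "cinner (a *\<^sub>C x) y = of_real (cmod (cinner x y))"
    using False complex_norm_square[of "cinner x y"]
    by (simp add: cinner_scaleC_left a_def field_simps power2_eq_square)
  then show ?thesis
    using Re_cinner_le[of "a *\<^sub>C x" y] by (simp add: norm_scaleC a)
qed auto

lemma bounded_bilinear_cinner: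
  "bounded_bilinear (cinner :: 'a::complex_hilbert \<Rightarrow> 'a \<Rightarrow> complex)"
proof
  show "\<exists>K. \<forall>a b::'a. cmod (cinner a b) \<le> norm a * norm b * K"
    by (rule exI[of _ 1]) (simp add: cmod_cinner_le)
qed (simp_all add: cinner_add_left cinner_add_right cinner_scaleR_left cinner_scaleR_right
      scaleR_conv_of_real)

lemmas tendsto_cinner = bounded_bilinear.tendsto[OF bounded_bilinear_cinner]

section \<open>Closed subspaces, nearest points and representation of functionals\<close>

lemma closed_csubspaceD:
  assumes "closed_csubspace M"
  shows "closed M" "0 \<in> M" "x \<in> M \<Longrightarrow> y \<in> M \<Longrightarrow> x + y \<in> M" "x \<in> M \<Longrightarrow> a *\<^sub>C x \<in> M"
    "x \<in> M \<Longrightarrow> r *\<^sub>R x \<in> M" "x \<in> M \<Longrightarrow> y \<in> M \<Longrightarrow> x - y \<in> M"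
proof -
  show "closed M" "0 \<in> M" "x \<in> M \<Longrightarrow> y \<in> M \<Longrightarrow> x + y \<in> M"
    and *: "x \<in> M \<Longrightarrow> a *\<^sub>C x \<in> M" for x y a
    using assms unfolding closed_csubspace_def by auto
  show "x \<in> M \<Longrightarrow> r *\<^sub>R x \<in> M"
    using *[of x "of_real r"] by (simp add: scaleC_of_real)
  show "x \<in> M \<Longrightarrow> y \<in> M \<Longrightarrow> x - y \<in> M"
    using *[of y "-1"] assms unfolding closed_csubspace_def
    by (metis scaleC_minus_one add_uminus_conv_diff)
qed

lemma closed_csubspace_UNIV [simp]: "closed_csubspace UNIV"
  by (simp add: closed_csubspace_def)

lemma closed_csubspace_sum:
  assumes "closed_csubspace M" "\<And>i. i \<in> A \<Longrightarrow> f i \<in> M"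
  shows "sum f A \<in> M"
  using assms(2)
  by (induction A rule: infinite_finite_induct) (auto intro: closed_csubspaceD[OF assms(1)])

lemma nearest_point_exists:
  assumes M: "closed_csubspace M"
  shows "\<exists>p\<in>M. \<forall>m\<in>M. norm (x - p) \<le> norm (x - m)"
proof -
  define D where "D = (INF m\<in>M. (norm (x - m))\<^sup>2)"
  have bdd: "bdd_below ((\<lambda>m. (norm (x - m))\<^sup>2) ` M)"
    by (rule bdd_belowI[of _ 0]) auto
  have ne: "M \<noteq> {}"
    using closed_csubspaceD(2)[OF M] by auto
  have Dle: "D \<le> (norm (x - m))\<^sup>2" if "m \<in> M" for m
    unfolding D_def by (rule cINF_lower[OF bdd that])
  have "\<exists>m\<in>M. (norm (x - m))\<^sup>2 < D + 1 / Suc n" for n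
    using cINF_less_iff[OF ne bdd, of "D + 1 / Suc n"] by (simp add: D_def)
  then obtain f where f: "\<And>n. f n \<in> M" "\<And>n. (norm (x - f n))\<^sup>2 < D + 1 / Suc n"
    by metis
  have para: "(norm (f i - f j))\<^sup>2 \<le> 2 / Suc i + 2 / Suc j" for i j
  proof -
    \<comment> \<open>The midpoint competes with the infimum \<open>D\<close>; the parallelogram
      identity for x - f i and x - f j then makes the minimising sequence Cauchy.\<close>
    have "(1/2) *\<^sub>R (f i + f j) \<in> M"
      by (intro closed_csubspaceD[OF M] f)
    from Dle[OF this] have 1: "4 * D \<le> (2 * norm (x - (1/2) *\<^sub>R (f i + f j)))\<^sup>2"
      by (simp add: power_mult_distrib)
    have "2 * norm (x - (1/2) *\<^sub>R (f i + f j)) = norm (2 *\<^sub>R (x - (1/2) *\<^sub>R (f i + f j)))"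
      by simp
    also have "2 *\<^sub>R (x - (1/2) *\<^sub>R (f i + f j)) = (x - f i) + (x - f j)"
      by (simp add: scaleR_right_diff_distrib scaleR_2)
    finally have "4 * D \<le> (norm ((x - f i) + (x - f j)))\<^sup>2"
      using 1 by simp
    moreover have "(norm (f i - f j))\<^sup>2 = (norm ((x - f i) - (x - f j)))\<^sup>2"
      by (simp add: norm_minus_commute)
    ultimately have "(norm (f i - f j))\<^sup>2 \<le> 2 * (norm (x - f i))\<^sup>2 + 2 * (norm (x - f j))\<^sup>2 - 4 * D"
      unfolding norm_add_sq norm_diff_sq[of "x - f i"] by linarith
    then show ?thesis
      using f(2)[of i] f(2)[of j] by simp
  qed
  have "Cauchy f"
  proof (rule metric_CauchyI)
    fix e :: real assume e: "e > 0"
    obtain N where N: "4 / e\<^sup>2 < real N"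
      using reals_Archimedean2 by blast
    have "dist (f i) (f j) < e" if "i \<ge> N" "j \<ge> N" for i j
    proof -
      have "4 / real (Suc N) < e\<^sup>2"
        using N e by (simp add: field_simps) (smt (verit) zero_less_power)
      moreover have "2 / real (Suc i) \<le> 2 / real (Suc N)" "2 / real (Suc j) \<le> 2 / real (Suc N)"
        using that by (auto intro!: divide_left_mono)
      ultimately have "(norm (f i - f j))\<^sup>2 < e\<^sup>2"
        using para[of i j] by linarith
      then show ?thesis
        using e by (simp add: dist_norm power2_less_imp_less)
    qed
    then show "\<exists>N. \<forall>i\<ge>N. \<forall>j\<ge>N. dist (f i) (f j) < e"
      by blast
  qed
  then obtain p where p: "f \<longlonglongrightarrow> p"
    using Cauchy_convergent_iff convergent_def by blast
  have pM: "p \<in> M"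
    using closed_sequentially[OF closed_csubspaceD(1)[OF M]] f(1) p by blast
  have l1: "(\<lambda>n. (norm (x - f n))\<^sup>2) \<longlonglongrightarrow> (norm (x - p))\<^sup>2"
    by (intro tendsto_intros p)
  have l2: "(\<lambda>n. D + 1 / Suc n) \<longlonglongrightarrow> D + 0"
    using LIMSEQ_inverse_real_of_nat by (intro tendsto_intros) (simp add: inverse_eq_divide)
  have "(norm (x - p))\<^sup>2 \<le> D + 0"
    using f(2) by (intro LIMSEQ_le[OF l1 l2]) (meson less_imp_le)
  then have "(norm (x - p))\<^sup>2 \<le> (norm (x - m))\<^sup>2" if "m \<in> M" for m
    using Dle[OF that] by linarith
  then show ?thesis
    using pM by (auto simp: abs_le_square_iff[symmetric])
qed

lemma projection_exists:
  assumes M: "closed_csubspace M"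
  shows "\<exists>p\<in>M. \<forall>m\<in>M. cinner m (x - p) = 0"
proof -
  obtain p where p: "p \<in> M" "\<And>m. m \<in> M \<Longrightarrow> norm (x - p) \<le> norm (x - m)"
    using nearest_point_exists[OF M] by blast
  have Re0: "Re (cinner m (x - p)) = 0" if m: "m \<in> M" for m
  proof -
    define b where "b = Re (cinner m (x - p))"
    have q: "2 * t * b \<le> t\<^sup>2 * (norm m)\<^sup>2" for t :: real
    proof -
      have "norm (x - p) \<le> norm (x - (p + t *\<^sub>R m))"
        by (intro p(2) closed_csubspaceD[OF M] m p(1))
      then have "(norm (x - p))\<^sup>2 \<le> (norm ((x - p) - t *\<^sub>R m))\<^sup>2"
        by (intro power_mono) (auto simp: algebra_simps)
      then show ?thesis
        unfolding norm_diff_sq[of "x - p"]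
        by (simp add: cinner_scaleR_right power_mult_distrib b_def Re_cinner_commute[of "x - p" m])
    qed
    \<comment> \<open>The parameter t = b / n imitates the minimiser b / |m|^2 of the quadratic; the
      added 1 covers m = 0.\<close>
    define n where "n = (norm m)\<^sup>2 + 1"
    have n: "n > 0" and "(norm m)\<^sup>2 \<le> n"
      by (auto simp: n_def add_nonneg_pos)
    then have "2 * (b / n) * b \<le> (b / n)\<^sup>2 * n"
      by (meson q[of "b / n"] mult_left_mono order_trans zero_le_power2)
    also have "(b / n)\<^sup>2 * n = (b / n) * b"
      using n by (simp add: power2_eq_square)
    finally have "b\<^sup>2 / n \<le> 0"
      by (simp add: power2_eq_square)
    then show ?thesis
      using n by (simp add: divide_le_0_iff b_def)
  qed
  have "cinner m (x - p) = 0" if m: "m \<in> M" for m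
  proof -
    have "Re (cinner (\<i> *\<^sub>C m) (x - p)) = 0"
      by (intro Re0 closed_csubspaceD[OF M] m)
    then show ?thesis
      using Re0[OF m] by (simp add: complex_eq_iff cinner_scaleC_left)
  qed
  then show ?thesis
    using p(1) by blast
qed

text \<open>Relative to a subspace because \<open>adj_on M\<close> is a definite description of a
  vector inside \<open>M\<close>, and blocks live on such subspaces.\<close>

lemma riesz_on:
  assumes M: "closed_csubspace M"
    and add: "\<And>x y. x \<in> M \<Longrightarrow> y \<in> M \<Longrightarrow> f (x + y) = f x + f y"
    and scale: "\<And>a x. x \<in> M \<Longrightarrow> f (a *\<^sub>C x) = a * f x"
    and bdd: "\<And>x. x \<in> M \<Longrightarrow> cmod (f x) \<le> K * norm x"
  shows "\<exists>z\<in>M. \<forall>x\<in>M. f x = cinner x z"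
proof (cases "\<forall>x\<in>M. f x = 0")
  case True
  then show ?thesis
    using closed_csubspaceD(2)[OF M] by (auto intro!: bexI[of _ 0])
next
  case False
  then obtain u where u: "u \<in> M" "f u \<noteq> 0"
    by blast
  have diff: "f (x - y) = f x - f y" if "x \<in> M" "y \<in> M" for x y
    using add[OF that(1) closed_csubspaceD(4)[OF M that(2), of "-1"]] scale[OF that(2), of "-1"]
    by simp
  define L where "L = {x \<in> M. f x = 0}"
  have "closed L"
    unfolding closed_sequential_limits
  proof (intro allI impI, elim conjE)
    fix g l assume g: "\<forall>n. g n \<in> L" "g \<longlonglongrightarrow> l"
    have lM: "l \<in> M"
      using closed_sequentially[OF closed_csubspaceD(1)[OF M] _ g(2)] g(1) by (auto simp: L_def)
    have le: "cmod (f l) \<le> K * norm (l - g n)" for n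
      using bdd[of "l - g n"] diff[of l "g n"] g(1) lM closed_csubspaceD(6)[OF M, of l "g n"]
      by (simp add: L_def)
    have "(\<lambda>n. K * norm (l - g n)) \<longlonglongrightarrow> K * norm (l - l)"
      by (intro tendsto_intros g)
    then have "cmod (f l) \<le> K * norm (l - l)"
      by (rule LIMSEQ_le_const) (use le in blast)
    then show "l \<in> L"
      using lM by (simp add: L_def)
  qed
  then have L: "closed_csubspace L"
    unfolding closed_csubspace_def L_def
    using closed_csubspaceD[OF M] add scale scale[of 0 0] by auto
  obtain p where p: "p \<in> L" "\<And>m. m \<in> L \<Longrightarrow> cinner m (u - p) = 0"
    using projection_exists[OF L] by blast
  define v where "v = u - p"
  have v: "v \<in> M" "f v = f u"
    using p(1) u closed_csubspaceD(6)[OF M] by (auto simp: v_def L_def diff)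
  have "v \<noteq> 0"
    using v u scale[OF v(1), of 0] by auto
  then have nv: "norm v \<noteq> 0"
    by simp
  have "f x = cinner x ((cnj (f v) / of_real ((norm v)\<^sup>2)) *\<^sub>C v)" if x: "x \<in> M" for x
  proof -
    have "x - (f x / f v) *\<^sub>C v \<in> L"
      using x v u closed_csubspaceD[OF M] by (auto simp: L_def diff scale)
    then have "cinner x v = f x / f v * of_real ((norm v)\<^sup>2)"
      using p(2) unfolding v_def[symmetric]
      by (fastforce simp: cinner_diff_left cinner_scaleC_left cinner_self)
    then show ?thesis
      using nv v u by (simp add: cinner_scaleC_right)
  qed
  then show ?thesis
    using closed_csubspaceD(4)[OF M v(1)] by blast
qed

section \<open>Adjoints, contractions and polynomials of an operator on a subspace\<close>

lemma cinner_adj_on: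
  assumes M: "closed_csubspace M" and A: "bounded_clinear_on M M A" and x: "x \<in> M"
  shows "cinner x (adj_on M A y) = cinner (A x) y"
proof -
  obtain K where K: "\<And>x. x \<in> M \<Longrightarrow> norm (A x) \<le> K * norm x"
    using A unfolding bounded_clinear_on_def by blast
  have "\<exists>z\<in>M. \<forall>x\<in>M. cinner (A x) y = cinner x z"
  proof (rule riesz_on[OF M])
    show "cmod (cinner (A x) y) \<le> (K * norm y) * norm x" if "x \<in> M" for x
      using cmod_cinner_le[of "A x" y] mult_right_mono[OF K[OF that], of "norm y"]
      by (simp add: algebra_simps)
  qed (use A in \<open>auto simp: bounded_clinear_on_def cinner_add_left cinner_scaleC_left\<close>)
  then obtain z where z: "z \<in> M \<and> (\<forall>x\<in>M. cinner (A x) y = cinner x z)"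
    by blast
  have "adj_on M A y \<in> M \<and> (\<forall>x\<in>M. cinner (A x) y = cinner x (adj_on M A y))"
    unfolding adj_on_def
  proof (rule theI)
    show "z \<in> M \<and> (\<forall>x\<in>M. cinner (A x) y = cinner x z)"
      by (rule z)
    fix w assume w: "w \<in> M \<and> (\<forall>x\<in>M. cinner (A x) y = cinner x w)"
    then have "cinner (w - z) (w - z) = 0"
      using z closed_csubspaceD(6)[OF M, of w z] by (metis cinner_diff_right right_minus_eq)
    then show "w = z"
      by (simp add: cinner_self_eq_0_iff)
  qed
  then show ?thesis
    using x by auto
qed

lemma contraction_onD:
  assumes "contraction_on M T"
  shows "bounded_clinear_on M M T" "x \<in> M \<Longrightarrow> T x \<in> M"
    "x \<in> M \<Longrightarrow> y \<in> M \<Longrightarrow> T (x + y) = T x + T y"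
    "x \<in> M \<Longrightarrow> T (a *\<^sub>C x) = a *\<^sub>C T x" "x \<in> M \<Longrightarrow> norm (T x) \<le> norm x"
  using assms unfolding contraction_on_def bounded_clinear_on_def by blast+

lemma contraction_onI:
  assumes "\<And>x. x \<in> M \<Longrightarrow> T x \<in> M" "\<And>x y. x \<in> M \<Longrightarrow> y \<in> M \<Longrightarrow> T (x + y) = T x + T y"
    "\<And>a x. x \<in> M \<Longrightarrow> T (a *\<^sub>C x) = a *\<^sub>C T x" "\<And>x. x \<in> M \<Longrightarrow> norm (T x) \<le> norm x"
  shows "contraction_on M T"
  unfolding contraction_on_def bounded_clinear_on_def using assms
  by (auto intro!: exI[of _ "1::real"])

lemma contraction_on_funpow: "contraction_on M T \<Longrightarrow> contraction_on M (T ^^ n)"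
proof (induction n)
  case 0
  show ?case
    by (rule contraction_onI) auto
next
  case (Suc n)
  note T = contraction_onD[OF Suc.prems] and Tn = contraction_onD[OF Suc.IH[OF Suc.prems]]
  show ?case
    by (rule contraction_onI) (auto simp: T Tn intro: order_trans[OF T(5) Tn(5)])
qed

lemma contraction_on_diff:
  assumes "contraction_on UNIV T"
  shows "T (x - y) = T x - T y"
  using contraction_onD(3)[OF assms, of "x - y" y] by (simp add: algebra_simps)

lemma contraction_on_zero: "contraction_on M T \<Longrightarrow> 0 \<in> M \<Longrightarrow> T 0 = 0"
  using contraction_onD(4)[of M T 0 0] by simp

lemma contraction_on_sum:
  assumes M: "closed_csubspace M" and T: "contraction_on M T" and f: "\<And>i. i \<in> A \<Longrightarrow> f i \<in> M"
  shows "T (sum f A) = (\<Sum>i\<in>A. T (f i))"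
  using f
proof (induction A rule: infinite_finite_induct)
  case (insert x F)
  then show ?case
    by (simp add: contraction_onD(3)[OF T] closed_csubspace_sum[OF M])
qed (auto simp: contraction_on_zero[OF T closed_csubspaceD(2)[OF M]])

lemma bounded_clinear_on_poly_op:
  assumes M: "closed_csubspace M" and T: "contraction_on M T"
  shows "bounded_clinear_on M M (poly_op p T)"
proof -
  note Tn = contraction_onD[OF contraction_on_funpow[OF T]]
  have "norm (poly_op p T x) \<le> (\<Sum>i\<le>degree p. cmod (coeff p i)) * norm x" if "x \<in> M" for x
    unfolding poly_op_def sum_distrib_right
    by (intro sum_norm_le) (auto simp: norm_scaleC intro!: mult_left_mono Tn that)
  moreover have "poly_op p T (x + y) = poly_op p T x + poly_op p T y" if "x \<in> M" "y \<in> M" for x y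
    by (simp add: poly_op_def Tn that scaleC_add_right sum.distrib)
  moreover have "poly_op p T (a *\<^sub>C x) = a *\<^sub>C poly_op p T x" if "x \<in> M" for a x
  proof -
    have "a *\<^sub>C sum f A = (\<Sum>i\<in>A. a *\<^sub>C f i)" for f :: "nat \<Rightarrow> 'a" and A
      by (induction A rule: infinite_finite_induct) (auto simp: scaleC_add_right)
    then show ?thesis
      by (simp add: poly_op_def Tn that scaleC_scaleC mult.commute)
  qed
  moreover have "poly_op p T x \<in> M" if "x \<in> M" for x
    unfolding poly_op_def by (intro closed_csubspace_sum[OF M] closed_csubspaceD[OF M] Tn that)
  ultimately show ?thesis
    unfolding bounded_clinear_on_def by blast
qed

text \<open>The form is real, so the reality clause of \<open>psd_on\<close> is automatic and
  \<open>op_le_on\<close> becomes an inequality between real parts.\<close>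

lemma cinner_re_op_on:
  assumes M: "closed_csubspace M" and A: "bounded_clinear_on M M A" and x: "x \<in> M"
  shows "cinner (re_op_on M A x) x = of_real (Re (cinner (A x) x))"
proof -
  have "cinner (adj_on M A x) x = cnj (cinner (A x) x)"
    using cinner_adj_on[OF M A x] by (metis cinner_commute)
  then show ?thesis
    by (simp add: re_op_on_def cinner_scaleR_left cinner_add_left complex_eq_iff)
qed

section \<open>Harnack domination and Toeplitz forms\<close>

text \<open>Quadratic forms replace operators: the form at a vector of an invariant subspace does
  not depend on the ambient space, so passing to a block merely shrinks the range of the vector.
  Coefficients are a sequence cut at \<open>n\<close>, which lets sums over powers be twisted and
  exchanged without reference to a degree.\<close>

definition harnack_bound ::
    "'a::complex_hilbert set \<Rightarrow> real \<Rightarrow> ('a \<Rightarrow> 'a) \<Rightarrow> ('a \<Rightarrow> 'a) \<Rightarrow> bool" where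
  "harnack_bound M c T T' \<longleftrightarrow>
     (\<forall>(a::nat \<Rightarrow> complex) n. (\<forall>z. cmod z \<le> 1 \<longrightarrow> 0 \<le> Re (\<Sum>i<n. a i * z ^ i)) \<longrightarrow>
        (\<forall>x\<in>M. Re (\<Sum>i<n. a i * cinner ((T ^^ i) x) x)
              \<le> c * Re (\<Sum>i<n. a i * cinner ((T' ^^ i) x) x)))"

lemma cinner_poly_op:
  "cinner (poly_op p T x) y = (\<Sum>i<Suc (degree p). coeff p i * cinner ((T ^^ i) x) y)"
  by (simp add: poly_op_def cinner_sum_left cinner_scaleC_left lessThan_Suc_atMost)

lemma harnack_dominated_on_iff:
  assumes M: "closed_csubspace M"
  shows "harnack_dominated_on M T T' \<longleftrightarrow>
    contraction_on M T \<and> contraction_on M T' \<and> (\<exists>c\<ge>1. harnack_bound M c T T')"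
proof -
  have eq: "(\<forall>p. (\<forall>z. cmod z \<le> 1 \<longrightarrow> 0 \<le> Re (poly p z)) \<longrightarrow>
             op_le_on M (re_op_on M (poly_op p T)) (\<lambda>x. c *\<^sub>R re_op_on M (poly_op p T') x))
      \<longleftrightarrow> harnack_bound M c T T'" (is "?L \<longleftrightarrow> ?R")
    if T: "contraction_on M T" and T': "contraction_on M T'" for c
  proof -
    have op_le: "op_le_on M (re_op_on M (poly_op p T)) (\<lambda>x. c *\<^sub>R re_op_on M (poly_op p T') x) \<longleftrightarrow>
      (\<forall>x\<in>M. Re (cinner (poly_op p T x) x) \<le> c * Re (cinner (poly_op p T' x) x))" for p
      unfolding op_le_on_def psd_on_def
      by (intro ball_cong)
        (auto simp: cinner_diff_left cinner_scaleR_left cinner_re_op_on[OF M]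
          bounded_clinear_on_poly_op[OF M] T T')
    show ?thesis
    proof
      assume L: ?L
      show ?R
        unfolding harnack_bound_def
      proof (intro allI impI ballI)
        fix a :: "nat \<Rightarrow> complex" and n x
        assume pos: "\<forall>z. cmod z \<le> 1 \<longrightarrow> 0 \<le> Re (\<Sum>i<n. a i * z ^ i)" and x: "x \<in> M"
        define p where "p = (\<Sum>i<n. monom (a i) i)"
        have co: "coeff p i = (if i < n then a i else 0)" for i
          by (simp add: p_def coeff_sum)
        have "poly p z = (\<Sum>i<n. a i * z ^ i)" for z
          by (simp add: p_def poly_sum poly_monom)
        moreover have "cinner (poly_op p V x) x = (\<Sum>i<n. a i * cinner ((V ^^ i) x) x)" for V
          unfolding cinner_poly_op
        \<comment> \<open>Neither index range contains the other in general: the degree drops when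
          leading coefficients vanish, while \<open>n = 0\<close> gives
          \<open>Suc (degree p) = 1\<close>.\<close>
        proof (rule sum.mono_neutral_cong)
          fix i assume "i \<in> {..<n} - {..<Suc (degree p)}"
          then have "coeff p i = 0" "i < n"
            by (auto simp: coeff_eq_0)
          then show "a i * cinner ((V ^^ i) x) x = 0"
            by (simp add: co)
        qed (auto simp: co)
        ultimately show "Re (\<Sum>i<n. a i * cinner ((T ^^ i) x) x)
              \<le> c * Re (\<Sum>i<n. a i * cinner ((T' ^^ i) x) x)"
          using L[unfolded op_le, rule_format, of p x] pos x by simp
      qed
    next
      assume R: ?R
      show ?L
        unfolding op_le cinner_poly_op
      proof (intro allI impI ballI)
        fix p :: "complex poly" and x
        assume "\<forall>z. cmod z \<le> 1 \<longrightarrow> 0 \<le> Re (poly p z)" and x: "x \<in> M"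
        then show "Re (\<Sum>i<Suc (degree p). coeff p i * cinner ((T ^^ i) x) x)
              \<le> c * Re (\<Sum>i<Suc (degree p). coeff p i * cinner ((T' ^^ i) x) x)"
          using R unfolding harnack_bound_def poly_altdef lessThan_Suc_atMost[symmetric] by blast
      qed
    qed
  qed
  show ?thesis
    unfolding harnack_dominated_on_def using eq by auto
qed

section \<open>Fejer kernels and averages over roots of unity\<close>

definition fejer_weight :: "nat \<Rightarrow> real" where
  "fejer_weight l = (if l = 0 then 1 else 2)"

lemma sum_fejer_weight_power:
  "(\<Sum>l<Suc n. of_real (fejer_weight l) * z ^ l) = 1 + 2 * (z * (\<Sum>i<n. z ^ i))" for z :: complex
  unfolding sum.lessThan_Suc_shift by (simp add: fejer_weight_def sum_distrib_left mult.assoc)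

text \<open>Equality holds on the unit circle. In the induction step, with y the old geometric sum,
  the right side grows by Re (1 + 2 z y), while the left side becomes 1 + |z y|^2 + 2 Re (z y);
  inside the disc |z y| \<le> |y| closes the gap.\<close>

lemma fejer_kernel_ge:
  assumes "cmod z \<le> 1"
  shows "(cmod (\<Sum>i<n. z ^ i))\<^sup>2 \<le> Re (\<Sum>l<n. of_real (fejer_weight l * (real n - real l)) * z ^ l)"
proof (induction n)
  case (Suc n)
  define y where "y = (\<Sum>i<n. z ^ i)"
  have "(\<Sum>l<Suc n. of_real (fejer_weight l * (real (Suc n) - real l)) * z ^ l)
      = (\<Sum>l<Suc n. of_real (fejer_weight l * (real n - real l)) * z ^ l)
        + (\<Sum>l<Suc n. of_real (fejer_weight l) * z ^ l)"
    unfolding sum.distrib[symmetric] by (intro sum.cong) (auto simp: algebra_simps)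
  also have "\<dots> = (\<Sum>l<n. of_real (fejer_weight l * (real n - real l)) * z ^ l) + (1 + 2 * (z * y))"
    unfolding sum_fejer_weight_power y_def by simp
  finally have "Re (\<Sum>l<Suc n. of_real (fejer_weight l * (real (Suc n) - real l)) * z ^ l)
      \<ge> (cmod y)\<^sup>2 + 1 + 2 * Re (z * y)"
    using Suc by (simp add: y_def)
  moreover have "(cmod (z * y))\<^sup>2 \<le> (cmod y)\<^sup>2"
    using assms by (intro power_mono) (auto simp: norm_mult mult_left_le_one_le)
  moreover have e: "(\<Sum>i<Suc n. z ^ i) = 1 + z * y"
    unfolding sum.lessThan_Suc_shift by (simp add: y_def sum_distrib_left)
  moreover have "(cmod (1 + z * y))\<^sup>2 = 1 + (cmod (z * y))\<^sup>2 + 2 * Re (z * y)"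
    unfolding cmod_power2 by (simp add: power2_eq_square algebra_simps)
  ultimately show ?case
    unfolding e by linarith
qed auto

lemma sum_roots_of_unity:
  fixes L :: nat
  defines "\<zeta> \<equiv> \<lambda>k::nat. cis (2 * pi * real k / real L)"
  assumes "p < L" "q < L"
  shows "(\<Sum>k<L. \<zeta> k ^ p * cnj (\<zeta> k) ^ q) = (if p = q then of_nat L else 0)"
proof -
  \<comment> \<open>Exchanging index and exponent turns the sum over k into a geometric sum.\<close>
  have swap: "\<zeta> k ^ i = \<zeta> i ^ k" for k i
    unfolding \<zeta>_def Complex.DeMoivre by (rule arg_cong[of _ _ cis]) simp
  have root: "\<zeta> i ^ L = 1" for i
    using assms(2) by (simp add: \<zeta>_def Complex.DeMoivre)
  have unit: "\<zeta> k * cnj (\<zeta> k) = 1" for k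
    by (simp add: \<zeta>_def cis_cnj cis_mult)
  define r where "r = \<zeta> p * cnj (\<zeta> q)"
  have geo: "\<zeta> k ^ p * cnj (\<zeta> k) ^ q = r ^ k" for k
    by (simp add: r_def power_mult_distrib swap flip: complex_cnj_power)
  show ?thesis
  proof (cases "p = q")
    case True
    then show ?thesis
      unfolding geo by (simp add: r_def unit)
  next
    case False
    have "inj_on \<zeta> {..<L}"
      using Complex.bij_betw_roots_unity[of L] assms(2) by (auto simp: bij_betw_def \<zeta>_def)
    then have ne: "\<zeta> p \<noteq> \<zeta> q"
      using False assms by (auto dest: inj_onD)
    have "r * \<zeta> q = \<zeta> p"
      using unit[of q] by (simp add: r_def mult.assoc mult.commute[of "cnj _"])
    then have "r \<noteq> 1"
      using ne by auto
    moreover have "r ^ L = 1"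
      by (simp add: r_def power_mult_distrib root flip: complex_cnj_power)
    ultimately show ?thesis
      unfolding geo using False by (simp add: sum_gp_strict)
  qed
qed

text \<open>The l-th diagonal of the Toeplitz form of the powers. The diagonal at -l, built from
  adjoint powers, is its complex conjugate, so the full form is the sum of the real parts weighted
  by \<open>fejer_weight\<close>.\<close>

definition toeplitz_diag ::
    "('a::complex_hilbert \<Rightarrow> 'a) \<Rightarrow> (nat \<Rightarrow> 'a) \<Rightarrow> nat \<Rightarrow> nat \<Rightarrow> complex" where
  "toeplitz_diag T h n l = (\<Sum>i<n. \<Sum>j<n. if i = j + l then cinner ((T ^^ l) (h i)) (h j) else 0)"

lemma toeplitz_diag_ge: "n \<le> l \<Longrightarrow> toeplitz_diag T h n l = 0"
  unfolding toeplitz_diag_def by (intro sum.neutral ballI) auto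

text \<open>
  Averaging over roots of unity isolates the pairs with i - j = l. This replaces the theorem that
  positive maps on a commutative C*-algebra are completely positive.
\<close>

lemma average_twisted_form:
  fixes L n :: nat and h :: "nat \<Rightarrow> 'a::complex_hilbert"
  defines "\<zeta> \<equiv> \<lambda>k::nat. cis (2 * pi * real k / real L)"
  defines "x \<equiv> \<lambda>k. (\<Sum>i<n. \<zeta> k ^ i *\<^sub>C h i)"
  assumes M: "closed_csubspace M" and T: "contraction_on M T" and h: "\<And>i. h i \<in> M"
    and L: "n + l < L"
  shows "(\<Sum>k<L. cnj (\<zeta> k) ^ l * cinner ((T ^^ l) (x k)) (x k)) = of_nat L * toeplitz_diag T h n l"
proof -
  note Tl = contraction_on_funpow[OF T, of l]
  have Tx: "(T ^^ l) (x k) = (\<Sum>i<n. \<zeta> k ^ i *\<^sub>C (T ^^ l) (h i))" for k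
    unfolding x_def
    by (subst contraction_on_sum[OF M Tl])
      (auto intro: closed_csubspaceD[OF M] h simp: contraction_onD(4)[OF Tl] h)
  have "cnj (\<zeta> k) ^ l * cinner ((T ^^ l) (x k)) (x k)
      = (\<Sum>i<n. \<Sum>j<n. (\<zeta> k ^ i * cnj (\<zeta> k) ^ (j + l)) * cinner ((T ^^ l) (h i)) (h j))" for k
    unfolding Tx unfolding x_def
    by (simp add: cinner_sum_left cinner_sum_right cinner_scaleC_left cinner_scaleC_right
        sum_distrib_left power_add mult_ac) (rule sum.swap)
  then have "(\<Sum>k<L. cnj (\<zeta> k) ^ l * cinner ((T ^^ l) (x k)) (x k))
      = (\<Sum>k<L. \<Sum>i<n. \<Sum>j<n. (\<zeta> k ^ i * cnj (\<zeta> k) ^ (j + l)) * cinner ((T ^^ l) (h i)) (h j))"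
    by simp
  also have "\<dots> = (\<Sum>i<n. \<Sum>k<L. \<Sum>j<n.
      (\<zeta> k ^ i * cnj (\<zeta> k) ^ (j + l)) * cinner ((T ^^ l) (h i)) (h j))"
    by (rule sum.swap)
  also have "\<dots> = (\<Sum>i<n. \<Sum>j<n. (\<Sum>k<L. \<zeta> k ^ i * cnj (\<zeta> k) ^ (j + l)) * cinner ((T ^^ l) (h i)) (h j))"
    unfolding sum_distrib_right
    by (intro sum.cong refl sum.swap)
  \<comment> \<open>Both exponents, i and j + l, stay below \<open>L\<close>, so orthogonality
    modulo \<open>L\<close> singles out i = j + l exactly.\<close>
  also have "\<dots> = of_nat L * toeplitz_diag T h n l"
    unfolding toeplitz_diag_def sum_distrib_left
    using L unfolding \<zeta>_def by (intro sum.cong refl) (subst sum_roots_of_unity, auto)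
  finally show ?thesis .
qed

lemma harnack_bound_toeplitz_fejer:
  assumes M: "closed_csubspace M" and T: "contraction_on M T" and T': "contraction_on M T'"
    and hb: "harnack_bound M c T T'" and h: "\<And>i. h i \<in> M"
  shows "(\<Sum>l<K. fejer_weight l * (real K - real l) * Re (toeplitz_diag T h n l))
    \<le> c * (\<Sum>l<K. fejer_weight l * (real K - real l) * Re (toeplitz_diag T' h n l))"
proof -
  \<comment> \<open>Large enough that n + l < L for every frequency l < K, and positive so that it
    cancels at the end.\<close>
  define L where "L = n + K + 1"
  define \<zeta> where "\<zeta> = (\<lambda>k::nat. cis (2 * pi * real k / real L))"
  define x where "x = (\<lambda>k. (\<Sum>i<n. \<zeta> k ^ i *\<^sub>C h i))"
  define v where "v l = fejer_weight l * (real K - real l)" for l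
  have xM: "x k \<in> M" for k
    unfolding x_def by (intro closed_csubspace_sum[OF M] closed_csubspaceD[OF M] h)
  have avg: "(\<Sum>k<L. Re (\<Sum>l<K. (of_real (v l) * cnj (\<zeta> k) ^ l) * cinner ((V ^^ l) (x k)) (x k)))
      = real L * (\<Sum>l<K. v l * Re (toeplitz_diag V h n l))" if V: "contraction_on M V" for V
  proof -
    have "(\<Sum>k<L. \<Sum>l<K. (of_real (v l) * cnj (\<zeta> k) ^ l) * cinner ((V ^^ l) (x k)) (x k))
        = (\<Sum>l<K. of_real (v l) * (\<Sum>k<L. cnj (\<zeta> k) ^ l * cinner ((V ^^ l) (x k)) (x k)))"
      by (subst sum.swap) (simp add: sum_distrib_left mult.assoc)
    also have "\<dots> = (\<Sum>l<K. of_real (v l) * (of_nat L * toeplitz_diag V h n l))"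
      unfolding x_def \<zeta>_def
      by (intro sum.cong refl, subst average_twisted_form[OF M V h]) (auto simp: L_def)
    finally show ?thesis
      unfolding Re_sum[symmetric] by (simp add: sum_distrib_left mult_ac)
  qed
  have "Re (\<Sum>l<K. (of_real (v l) * cnj (\<zeta> k) ^ l) * cinner ((T ^^ l) (x k)) (x k))
      \<le> c * Re (\<Sum>l<K. (of_real (v l) * cnj (\<zeta> k) ^ l) * cinner ((T' ^^ l) (x k)) (x k))" for k
  proof -
    have "0 \<le> Re (\<Sum>l<K. (of_real (v l) * cnj (\<zeta> k) ^ l) * z ^ l)" if z: "cmod z \<le> 1" for z
    proof -
      have "cmod (cnj (\<zeta> k) * z) \<le> 1"
        using z by (simp add: norm_mult \<zeta>_def)
      from fejer_kernel_ge[OF this, of K] show ?thesis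
        by (simp add: v_def power_mult_distrib mult.assoc order_trans[OF zero_le_power2])
    qed
    then show ?thesis
      using hb[unfolded harnack_bound_def, rule_format,
          of "\<lambda>l. of_real (v l) * cnj (\<zeta> k) ^ l" K "x k"] xM by blast
  qed
  then have "(\<Sum>k<L. Re (\<Sum>l<K. (of_real (v l) * cnj (\<zeta> k) ^ l) * cinner ((T ^^ l) (x k)) (x k)))
      \<le> (\<Sum>k<L. c * Re (\<Sum>l<K. (of_real (v l) * cnj (\<zeta> k) ^ l) * cinner ((T' ^^ l) (x k)) (x k)))"
    by (rule sum_mono)
  then have "real L * (\<Sum>l<K. v l * Re (toeplitz_diag T h n l))
      \<le> real L * (c * (\<Sum>l<K. v l * Re (toeplitz_diag T' h n l)))"
    unfolding sum_distrib_left[symmetric] avg[OF T] avg[OF T'] by (simp add: mult_ac)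
  then show ?thesis
    by (simp add: L_def v_def)
qed

text \<open>For K > n the diagonals from n on vanish, so after division by K the order enters only
  through the factors 1 - l / K, which tend to 1.\<close>

lemma harnack_bound_toeplitz:
  assumes M: "closed_csubspace M" and T: "contraction_on M T" and T': "contraction_on M T'"
    and hb: "harnack_bound M c T T'" and h: "\<And>i. h i \<in> M"
  shows "(\<Sum>l<n. fejer_weight l * Re (toeplitz_diag T h n l))
    \<le> c * (\<Sum>l<n. fejer_weight l * Re (toeplitz_diag T' h n l))"
proof -
  define s where "s V K = (\<Sum>l<n. fejer_weight l * (1 - real l / real K) * Re (toeplitz_diag V h n l))"
    for V K
  have lim: "s V \<longlonglongrightarrow> (\<Sum>l<n. fejer_weight l * (1 - 0) * Re (toeplitz_diag V h n l))" for V
    unfolding s_def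
    by (intro tendsto_intros real_tendsto_divide_at_top[OF tendsto_const] filterlim_real_sequentially)
  have cut: "(\<Sum>l<K. fejer_weight l * (real K - real l) * Re (toeplitz_diag V h n l)) = real K * s V K"
    if "n < K" for V K
  proof -
    have "(\<Sum>l<K. fejer_weight l * (real K - real l) * Re (toeplitz_diag V h n l))
        = (\<Sum>l<n. fejer_weight l * (real K - real l) * Re (toeplitz_diag V h n l))"
      using that by (intro sum.mono_neutral_right) (auto simp: toeplitz_diag_ge)
    also have "\<dots> = real K * s V K"
      unfolding s_def sum_distrib_left using that
      by (intro sum.cong refl) (auto simp: field_simps)
    finally show ?thesis .
  qed
  have "s T K \<le> c * s T' K" if "K \<ge> Suc n" for K
  proof -
    have "real K * s T K \<le> real K * (c * s T' K)"
      using harnack_bound_toeplitz_fejer[OF assms(1-4), of h K n] h that unfolding cut[OF Suc_le_lessD[OF that]]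
      by (simp add: mult_ac)
    then show ?thesis
      using that by simp
  qed
  then have "(\<Sum>l<n. fejer_weight l * (1 - 0) * Re (toeplitz_diag T h n l))
      \<le> c * (\<Sum>l<n. fejer_weight l * (1 - 0) * Re (toeplitz_diag T' h n l))"
    by (intro LIMSEQ_le[OF lim tendsto_mult_left[OF lim]]) blast
  then show ?thesis
    by simp
qed

lemma harnack_bound_one_step:
  assumes T: "contraction_on UNIV T" and T': "contraction_on UNIV T'"
    and hb: "harnack_bound UNIV c T T'"
  shows "(norm (T' x - T x))\<^sup>2 + (norm x)\<^sup>2 - (norm (T x))\<^sup>2 \<le> c * ((norm x)\<^sup>2 - (norm (T' x))\<^sup>2)"
proof -
  \<comment> \<open>With second vector - x, the form of \<open>T'\<close> in the first vector u is
    |u|^2 + |x|^2 - 2 Re <T' x, u>. It is least at u = T' x, where it equals the defect |x|^2 - |T'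
    x|^2.\<close>
  define h where "h i = (if i = 0 then T' x else - x)" for i :: nat
  have neg: "V (- x) = - V x" if "contraction_on UNIV V" for V
    using contraction_onD(4)[OF that, of x "-1"] by simp
  have form: "(\<Sum>l<2. fejer_weight l * Re (toeplitz_diag V h 2 l))
      = (norm (T' x))\<^sup>2 + (norm x)\<^sup>2 - 2 * Re (cinner (V x) (T' x))" if "contraction_on UNIV V" for V
    using neg[OF that]
    by (simp add: toeplitz_diag_def fejer_weight_def h_def numeral_2_eq_2 Re_cinner_self
        cinner_minus_left cinner_minus_right)
  show ?thesis
    using harnack_bound_toeplitz[OF closed_csubspace_UNIV T T' hb, of h 2]
    unfolding form[OF T] form[OF T']
    by (simp add: norm_diff_sq Re_cinner_self Re_cinner_commute[of "T x"] algebra_simps)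
qed

section \<open>Norms along orbits and the transfer of null orbits\<close>

lemma decseq_norm_funpow:
  assumes "contraction_on UNIV T"
  shows "decseq (\<lambda>n. norm ((T ^^ n) x))"
  by (rule decseq_SucI) (simp add: contraction_onD(5)[OF assms])

text \<open>Its square is the quadratic form of the asymptotic limit
  (\<open>Re_cinner_asymp_limit\<close>); in terms of norms the Harnack estimates run without
  adjoints.\<close>

definition asymp_norm :: "('a::complex_hilbert \<Rightarrow> 'a) \<Rightarrow> 'a \<Rightarrow> real" where
  "asymp_norm T x = lim (\<lambda>n. norm ((T ^^ n) x))"

lemma asymp_norm_tendsto:
  assumes "contraction_on UNIV T"
  shows "(\<lambda>n. norm ((T ^^ n) x)) \<longlonglongrightarrow> asymp_norm T x"
proof -
  obtain L where "(\<lambda>n. norm ((T ^^ n) x)) \<longlonglongrightarrow> L"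
    using decseq_convergent[OF decseq_norm_funpow[OF assms], of 0 x] by auto
  then show ?thesis
    by (simp add: asymp_norm_def limI)
qed

lemma asymp_norm_eq_0_iff:
  assumes "contraction_on UNIV T"
  shows "asymp_norm T x = 0 \<longleftrightarrow> (\<lambda>n. (T ^^ n) x) \<longlonglongrightarrow> 0"
  using asymp_norm_tendsto[OF assms, of x] tendsto_norm_zero_iff LIMSEQ_unique by metis

lemma asymp_norm_nonneg: "contraction_on UNIV T \<Longrightarrow> 0 \<le> asymp_norm T x"
  by (rule LIMSEQ_le_const[OF asymp_norm_tendsto]) auto

lemma asymp_norm_le_norm_funpow:
  assumes "contraction_on UNIV T"
  shows "asymp_norm T x \<le> norm ((T ^^ n) x)"
  by (rule decseq_ge[OF decseq_norm_funpow asymp_norm_tendsto]) (rule assms)+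

lemma asymp_norm_le_norm: "contraction_on UNIV T \<Longrightarrow> asymp_norm T x \<le> norm x"
  using asymp_norm_le_norm_funpow[of T x 0] by simp

lemma asymp_norm_image:
  assumes "contraction_on UNIV T"
  shows "asymp_norm T (T x) = asymp_norm T x"
proof -
  have "(\<lambda>n. norm ((T ^^ n) (T x))) \<longlonglongrightarrow> asymp_norm T x"
    using LIMSEQ_Suc[OF asymp_norm_tendsto[OF assms, of x]] by (simp add: funpow_swap1)
  then show ?thesis
    using asymp_norm_tendsto[OF assms] LIMSEQ_unique by blast
qed

lemma asymp_norm_cong:
  assumes T: "contraction_on UNIV T" and null: "(\<lambda>n. (T ^^ n) (x - y)) \<longlonglongrightarrow> 0"
  shows "asymp_norm T x = asymp_norm T y"
proof -
  note Tn = contraction_on_funpow[OF T]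
  have "(\<lambda>n. norm ((T ^^ n) x) - norm ((T ^^ n) y)) \<longlonglongrightarrow> 0"
  proof (rule Lim_null_comparison)
    show "\<forall>\<^sub>F n in sequentially. norm (norm ((T ^^ n) x) - norm ((T ^^ n) y)) \<le> norm ((T ^^ n) (x - y))"
      by (simp add: contraction_on_diff[OF Tn] norm_triangle_ineq3)
    show "(\<lambda>n. norm ((T ^^ n) (x - y))) \<longlonglongrightarrow> 0"
      using null by (simp add: tendsto_norm_zero)
  qed
  then show ?thesis
    using LIMSEQ_unique[OF _ tendsto_diff[OF asymp_norm_tendsto[OF T] asymp_norm_tendsto[OF T]]]
    by fastforce
qed

lemma funpow_commuting:
  assumes "\<And>x. f (g x) = g (f x)"
  shows "(f ^^ m) ((g ^^ n) x) = (g ^^ n) ((f ^^ m) x)"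
proof -
  have 1: "f ((g ^^ n) x) = (g ^^ n) (f x)" for x
    by (induction n) (auto simp: assms)
  show ?thesis
    by (induction m) (auto simp: 1)
qed

text \<open>Commutation turns the vector into T' y - T y with y = \<open>(T' ^^ k) x\<close>. There
  the one-step bound is c times |y|^2 - |T' y|^2, a difference of consecutive terms of a convergent
  sequence; the term |y|^2 - |T y|^2 on the smaller side is nonnegative and is dropped.\<close>

lemma harnack_difference_null:
  assumes T: "contraction_on UNIV T" and T': "contraction_on UNIV T'"
    and comm: "\<And>x. T (T' x) = T' (T x)" and hb: "harnack_bound UNIV c T T'"
  shows "(\<lambda>k. (T' ^^ k) (T' x - T x)) \<longlonglongrightarrow> 0"
proof -
  define b where "b k = c * ((norm ((T' ^^ k) x))\<^sup>2 - (norm ((T' ^^ Suc k) x))\<^sup>2)" for k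
  have le: "(norm ((T' ^^ k) (T' x - T x)))\<^sup>2 \<le> b k" for k
  proof -
    have eq: "(T' ^^ k) (T' x - T x) = T' ((T' ^^ k) x) - T ((T' ^^ k) x)"
      using funpow_commuting[of T T' 1 k x] comm
      by (simp add: contraction_on_diff[OF contraction_on_funpow[OF T']] funpow_swap1)
    moreover have "(norm (T ((T' ^^ k) x)))\<^sup>2 \<le> (norm ((T' ^^ k) x))\<^sup>2"
      by (intro power_mono contraction_onD(5)[OF T]) auto
    ultimately show ?thesis
      using harnack_bound_one_step[OF T T' hb, of "(T' ^^ k) x"]
      unfolding eq b_def funpow.simps o_apply by linarith
  qed
  have "b \<longlonglongrightarrow> c * ((asymp_norm T' x)\<^sup>2 - (asymp_norm T' x)\<^sup>2)"
    unfolding b_def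
    by (intro tendsto_intros asymp_norm_tendsto[OF T'] LIMSEQ_Suc[OF asymp_norm_tendsto[OF T']])
  then have "b \<longlonglongrightarrow> 0"
    by simp
  then have "(\<lambda>k. (norm ((T' ^^ k) (T' x - T x)))\<^sup>2) \<longlonglongrightarrow> 0"
    by (rule Lim_null_comparison[rotated]) (simp add: le)
  then have "(\<lambda>k. sqrt ((norm ((T' ^^ k) (T' x - T x)))\<^sup>2)) \<longlonglongrightarrow> sqrt 0"
    by (rule tendsto_real_sqrt)
  then show ?thesis
    by (simp add: tendsto_norm_zero_iff)
qed

lemma toeplitz_diag_eq:
  "toeplitz_diag T h n l = (\<Sum>j<n - l. cinner ((T ^^ l) (h (j + l))) (h j))"
proof -
  have "toeplitz_diag T h n l
      = (\<Sum>j<n. \<Sum>i<n. if i = j + l then cinner ((T ^^ l) (h i)) (h j) else 0)"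
    unfolding toeplitz_diag_def by (rule sum.swap)
  also have "\<dots> = (\<Sum>j<n. if j < n - l then cinner ((T ^^ l) (h (j + l))) (h j) else 0)"
    by (intro sum.cong refl) auto
  also have "\<dots> = (\<Sum>j<n - l. cinner ((T ^^ l) (h (j + l))) (h j))"
    by (rule sum.mono_neutral_cong_right) auto
  finally show ?thesis .
qed

lemma cesaro_null:
  fixes a :: "nat \<Rightarrow> real"
  assumes a: "a \<longlonglongrightarrow> 0" and nonneg: "\<And>n. 0 \<le> a n"
  shows "(\<lambda>n. (\<Sum>l<n. a l) / real n) \<longlonglongrightarrow> 0"
proof (rule LIMSEQ_I)
  fix e :: real assume e: "e > 0"
  obtain m where m: "\<And>n. n \<ge> m \<Longrightarrow> a n < e / 2"
    using LIMSEQ_D[OF a, of "e / 2"] e nonneg by (auto simp: abs_of_nonneg)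
  define C where "C = (\<Sum>l<m. a l)"
  obtain k where k: "2 * C / e < real k"
    using reals_Archimedean2 by blast
  have "(\<Sum>l<n. a l) / real n < e" if n: "n \<ge> max (Suc m) k" for n
  proof -
    have "(\<Sum>l<n. a l) = C + (\<Sum>l=m..<n. a l)"
      using sum.atLeastLessThan_concat[of 0 m n a] n by (simp add: C_def lessThan_atLeast0)
    also have "(\<Sum>l=m..<n. a l) \<le> of_nat (card {m..<n}) * (e / 2)"
      by (rule sum_bounded_above) (use m in \<open>auto intro: less_imp_le\<close>)
    also have "\<dots> \<le> real n * (e / 2)"
      using e by (intro mult_right_mono) auto
    finally have "(\<Sum>l<n. a l) \<le> C + real n * (e / 2)"
      by simp
    moreover have "C < real n * (e / 2)"
      using k n e by (simp add: field_simps) (smt (verit) mult_left_mono of_nat_mono)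
    ultimately show ?thesis
      using n by (simp add: field_simps)
  qed
  moreover have "0 \<le> (\<Sum>l<n. a l)" for n
    by (intro sum_nonneg nonneg)
  ultimately show "\<exists>n0. \<forall>n\<ge>n0. norm ((\<Sum>l<n. a l) / real n - 0) < e"
    by (intro exI[of _ "max (Suc m) k"]) (auto simp: abs_of_nonneg)
qed

lemma fejer_weight_bounds: "1 \<le> fejer_weight l" "fejer_weight l \<le> 2"
  by (auto simp: fejer_weight_def)

lemma harnack_null_transfer:
  assumes T: "contraction_on UNIV T" and T': "contraction_on UNIV T'"
    and comm: "\<And>x. T (T' x) = T' (T x)" and hb: "harnack_bound UNIV c T T'" and c: "c \<ge> 0"
    and null: "(\<lambda>n. (T' ^^ n) x) \<longlonglongrightarrow> 0"
  shows "(\<lambda>n. (T ^^ n) x) \<longlonglongrightarrow> 0"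
proof -
  \<comment> \<open>The factor 4 is 2 from \<open>fejer_weight l \<le> 2\<close> times 2 from N (N +
    1) / 2 \<ge> N^2 / 2, the number of pairs on the diagonals 0, ..., N - 1.\<close>
  define b where "b N = 4 * c * norm x * ((\<Sum>l<N. norm ((T' ^^ l) x)) / real N)" for N
  have le: "(norm ((T ^^ N) x))\<^sup>2 \<le> b N" if N: "N > 0" for N
  proof -
    \<comment> \<open>Chosen so that \<open>(T ^^ l) (h (j + l)) = h j\<close> for j + l < N: every
      entry in the form of \<open>T\<close> is then a square |h j|^2, at least |T^N x|^2 because
      norms decrease along the orbit.\<close>
    define h where "h i = (T ^^ (N - i)) x" for i
    define a where "a = (norm ((T ^^ N) x))\<^sup>2"
    have a: "a \<ge> 0"
      by (simp add: a_def)
    have lower: "fejer_weight l * Re (toeplitz_diag T h N l) \<ge> (real N - real l) * a" if l: "l < N" for l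
    proof -
      have "Re (cinner ((T ^^ l) (h (j + l))) (h j)) \<ge> a" if "j < N - l" for j
      proof -
        have "(T ^^ l) (h (j + l)) = (T ^^ (N - j)) x"
          using that by (simp add: h_def flip: funpow_add o_apply[of "T ^^ l"])
        moreover have "norm ((T ^^ N) x) \<le> norm ((T ^^ (N - j)) x)"
          using decseqD[OF decseq_norm_funpow[OF T], of "N - j" N x] by simp
        ultimately show ?thesis
          by (simp add: h_def Re_cinner_self a_def power_mono)
      qed
      then have "(\<Sum>j<N - l. a) \<le> Re (toeplitz_diag T h N l)"
        unfolding toeplitz_diag_eq Re_sum by (intro sum_mono) auto
      then have "(real N - real l) * a \<le> Re (toeplitz_diag T h N l)"
        using l by (simp add: of_nat_diff)
      moreover have "0 \<le> (real N - real l) * a"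
        using l a by simp
      ultimately show ?thesis
        using mult_mono[OF fejer_weight_bounds(1)[of l], of "(real N - real l) * a"]
          fejer_weight_bounds(1)[of l] by simp
    qed
    \<comment> \<open>By commutation \<open>T' ^^ l\<close> acts on x first, the remaining power of
      \<open>T\<close> is a contraction, and a diagonal has at most N entries.\<close>
    have upper: "fejer_weight l * Re (toeplitz_diag T' h N l)
        \<le> 2 * (real N * (norm ((T' ^^ l) x) * norm x))" if l: "l < N" for l
    proof -
      have "Re (cinner ((T' ^^ l) (h (j + l))) (h j)) \<le> norm ((T' ^^ l) x) * norm x" for j
      proof -
        have "(T' ^^ l) (h (j + l)) = (T ^^ (N - (j + l))) ((T' ^^ l) x)"
          unfolding h_def by (rule funpow_commuting) (simp add: comm)
        then have "norm ((T' ^^ l) (h (j + l))) \<le> norm ((T' ^^ l) x)"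
          by (simp add: contraction_onD(5)[OF contraction_on_funpow[OF T]])
        moreover have "norm (h j) \<le> norm x"
          by (simp add: h_def contraction_onD(5)[OF contraction_on_funpow[OF T]])
        ultimately show ?thesis
          by (intro order_trans[OF Re_cinner_le] mult_mono) auto
      qed
      then have "Re (toeplitz_diag T' h N l) \<le> (\<Sum>j<N - l. norm ((T' ^^ l) x) * norm x)"
        unfolding toeplitz_diag_eq Re_sum by (intro sum_mono) auto
      also have "\<dots> \<le> real N * (norm ((T' ^^ l) x) * norm x)"
        by (simp add: mult_right_mono)
      finally have "Re (toeplitz_diag T' h N l) \<le> real N * (norm ((T' ^^ l) x) * norm x)" .
      moreover have "0 \<le> real N * (norm ((T' ^^ l) x) * norm x)"
        by simp
      ultimately show ?thesis
        using fejer_weight_bounds[of l] by (meson mult_left_mono mult_right_mono order_trans zero_le_one)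
    qed
    have tri: "2 * (\<Sum>l<N. real N - real l) = real N * (real N + 1)"
    proof (induction N)
      case (Suc n)
      have "(\<Sum>l<Suc n. real (Suc n) - real l) = real (Suc n) + (\<Sum>l<n. real n - real l)"
        unfolding sum.lessThan_Suc_shift by simp
      with Suc show ?case
        by (simp add: algebra_simps)
    qed auto
    have "real N * real N * a \<le> (real N * (real N + 1)) * a"
      using a by (intro mult_right_mono) (auto simp: algebra_simps)
    also have "\<dots> = 2 * (\<Sum>l<N. (real N - real l) * a)"
      unfolding tri[symmetric] by (simp add: sum_distrib_right mult.assoc)
    also have "(\<Sum>l<N. (real N - real l) * a) \<le> (\<Sum>l<N. fejer_weight l * Re (toeplitz_diag T h N l))"
      by (intro sum_mono lower) auto
    also have "\<dots> \<le> c * (\<Sum>l<N. fejer_weight l * Re (toeplitz_diag T' h N l))"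
      by (rule harnack_bound_toeplitz[OF closed_csubspace_UNIV T T' hb]) auto
    also have "\<dots> \<le> c * (\<Sum>l<N. 2 * (real N * (norm ((T' ^^ l) x) * norm x)))"
      by (intro mult_left_mono[OF _ c] sum_mono upper) auto
    also have "2 * \<dots> = real N * (4 * c * norm x * (\<Sum>l<N. norm ((T' ^^ l) x)))"
      by (simp add: sum_distrib_left sum_distrib_right mult_ac)
    finally show ?thesis
      using N by (simp add: b_def a_def field_simps)
  qed
  have "b \<longlonglongrightarrow> 4 * c * norm x * 0"
    unfolding b_def by (intro tendsto_intros cesaro_null) (use null tendsto_norm_zero in auto)
  then have "b \<longlonglongrightarrow> 0"
    by simp
  then have "(\<lambda>n. (norm ((T ^^ n) x))\<^sup>2) \<longlonglongrightarrow> 0"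
    by (rule Lim_null_comparison[rotated]) (auto intro!: eventually_sequentiallyI[of 1] le)
  then have "(\<lambda>n. sqrt ((norm ((T ^^ n) x))\<^sup>2)) \<longlonglongrightarrow> sqrt 0"
    by (rule tendsto_real_sqrt)
  then show ?thesis
    by (simp add: tendsto_norm_zero_iff)
qed

lemma harnack_asymp_norm_image:
  assumes T: "contraction_on UNIV T" and T': "contraction_on UNIV T'"
    and comm: "\<And>x. T (T' x) = T' (T x)" and hb: "harnack_bound UNIV c T T'"
  shows "asymp_norm T' ((T ^^ n) x) = asymp_norm T' x"
proof (induction n)
  case (Suc n)
  \<comment> \<open>\<open>T y\<close> and \<open>T' y\<close> differ by a vector with null orbit
    under \<open>T'\<close>, and \<open>T'\<close> preserves its own asymptotic norm.\<close>
  have "asymp_norm T' (T y) = asymp_norm T' y" for y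
    using asymp_norm_cong[OF T' harnack_difference_null[OF assms]] asymp_norm_image[OF T'] by metis
  with Suc show ?case
    by simp
qed auto

lemma harnack_null_iff:
  assumes T: "contraction_on UNIV T" and T': "contraction_on UNIV T'"
    and comm: "\<And>x. T (T' x) = T' (T x)" and hb: "harnack_bound UNIV c T T'" and c: "c \<ge> 0"
  shows "(\<lambda>n. (T ^^ n) x) \<longlonglongrightarrow> 0 \<longleftrightarrow> (\<lambda>n. (T' ^^ n) x) \<longlonglongrightarrow> 0"
proof
  assume "(\<lambda>n. (T ^^ n) x) \<longlonglongrightarrow> 0"
  then have "(\<lambda>n. norm ((T ^^ n) x)) \<longlonglongrightarrow> 0"
    by (rule tendsto_norm_zero)
  moreover have "asymp_norm T' x \<le> norm ((T ^^ n) x)" for n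
    using asymp_norm_le_norm[OF T', of "(T ^^ n) x"] harnack_asymp_norm_image[OF T T' comm hb] by simp
  ultimately have "asymp_norm T' x \<le> 0"
    by (intro LIMSEQ_le_const) auto
  then show "(\<lambda>n. (T' ^^ n) x) \<longlonglongrightarrow> 0"
    using asymp_norm_nonneg[OF T', of x] asymp_norm_eq_0_iff[OF T', of x] by simp
qed (rule harnack_null_transfer[OF assms])

section \<open>The asymptotic limit\<close>

lemma cinner_ext: "(\<And>x. cinner x y = cinner x z) \<Longrightarrow> y = (z::'a::complex_hilbert)"
  using cinner_self_eq_0_iff[of "y - z"] by (simp add: cinner_diff_right)

lemma contraction_on_adj:
  assumes T: "contraction_on UNIV T"
  shows "contraction_on UNIV (adj_on UNIV T)"
proof -
  note adj = cinner_adj_on[OF closed_csubspace_UNIV contraction_onD(1)[OF T] UNIV_I]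
  show ?thesis
  proof (rule contraction_onI)
    fix x y :: 'a and a
    show "adj_on UNIV T (x + y) = adj_on UNIV T x + adj_on UNIV T y"
      by (rule cinner_ext) (simp add: adj cinner_add_right)
    show "adj_on UNIV T (a *\<^sub>C x) = a *\<^sub>C adj_on UNIV T x"
      by (rule cinner_ext) (simp add: adj cinner_scaleC_right)
    let ?z = "adj_on UNIV T x"
    have "norm ?z * norm ?z = Re (cinner (T ?z) x)"
      using Re_cinner_self[of ?z] by (simp add: adj power2_eq_square)
    also have "\<dots> \<le> norm (T ?z) * norm x"
      by (rule Re_cinner_le)
    also have "\<dots> \<le> norm ?z * norm x"
      by (intro mult_right_mono contraction_onD(5)[OF T]) auto
    finally show "norm ?z \<le> norm x"
      by (cases "norm ?z = 0") (auto simp: mult_le_cancel_left)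
  qed auto
qed

lemma cinner_adj_funpow:
  assumes T: "contraction_on UNIV T"
  shows "cinner x ((adj_on UNIV T ^^ n) y) = cinner ((T ^^ n) x) y"
proof (induction n arbitrary: x)
  case (Suc n)
  have "cinner x ((adj_on UNIV T ^^ Suc n) y) = cinner ((T ^^ n) (T x)) y"
    by (simp add: cinner_adj_on[OF closed_csubspace_UNIV contraction_onD(1)[OF T] UNIV_I] Suc)
  then show ?case
    by (simp add: funpow_swap1)
qed auto

definition asymp_approx :: "('a::complex_hilbert \<Rightarrow> 'a) \<Rightarrow> nat \<Rightarrow> 'a \<Rightarrow> 'a" where
  "asymp_approx T n x = (adj_on UNIV T ^^ n) ((T ^^ n) x)"

lemma norm_asymp_approx_le:
  assumes T: "contraction_on UNIV T"
  shows "norm (asymp_approx T n x) \<le> norm ((T ^^ n) x)"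
  unfolding asymp_approx_def
  by (rule contraction_onD(5)[OF contraction_on_funpow[OF contraction_on_adj[OF T]]]) simp

text \<open>The cross term of the expanded square is exactly -2 |T^n x|^2, and |T*^n T^n x|^2 \<le>
  |T^n x|^2 gives back at most half of it.\<close>

lemma norm_minus_asymp_approx:
  assumes T: "contraction_on UNIV T"
  shows "(norm (x - asymp_approx T n x))\<^sup>2 \<le> (norm x)\<^sup>2 - (norm ((T ^^ n) x))\<^sup>2"
proof -
  have "Re (cinner x (asymp_approx T n x)) = (norm ((T ^^ n) x))\<^sup>2"
    by (simp add: asymp_approx_def cinner_adj_funpow[OF T] Re_cinner_self)
  moreover have "(norm (asymp_approx T n x))\<^sup>2 \<le> (norm ((T ^^ n) x))\<^sup>2"
    by (intro power_mono norm_asymp_approx_le[OF T]) auto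
  ultimately show ?thesis
    by (simp add: norm_diff_sq)
qed

text \<open>With u = T^n x and m = n + k the difference is the contraction T*^n applied to u - T*^k
  T^k u, so the previous estimate applies at u. Increments are thus controlled by those of the
  convergent sequence |T^n x|^2, which yields strong convergence.\<close>

lemma norm_asymp_approx_diff:
  assumes T: "contraction_on UNIV T" and nm: "n \<le> m"
  shows "(norm (asymp_approx T n x - asymp_approx T m x))\<^sup>2 \<le> (norm ((T ^^ n) x))\<^sup>2 - (norm ((T ^^ m) x))\<^sup>2"
proof -
  obtain k where m: "m = n + k"
    using nm le_Suc_ex by blast
  note An = contraction_on_funpow[OF contraction_on_adj[OF T], of n]
  let ?u = "(T ^^ n) x"
  have Tm: "(T ^^ m) x = (T ^^ k) ?u"
    unfolding m add.commute[of n k] by (simp add: funpow_add)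
  then have "asymp_approx T m x = (adj_on UNIV T ^^ n) (asymp_approx T k ?u)"
    unfolding asymp_approx_def by (simp add: m funpow_add)
  then have "asymp_approx T n x - asymp_approx T m x
      = (adj_on UNIV T ^^ n) (?u - asymp_approx T k ?u)"
    by (simp add: contraction_on_diff[OF An] asymp_approx_def)
  then have "(norm (asymp_approx T n x - asymp_approx T m x))\<^sup>2 \<le> (norm (?u - asymp_approx T k ?u))\<^sup>2"
    by (intro power_mono) (auto intro: contraction_onD(5)[OF An])
  also have "\<dots> \<le> (norm ?u)\<^sup>2 - (norm ((T ^^ m) x))\<^sup>2"
    unfolding Tm by (rule norm_minus_asymp_approx[OF T])
  finally show ?thesis .
qed

lemma asymp_approx_tendsto:
  assumes T: "contraction_on UNIV T"
  shows "(\<lambda>n. asymp_approx T n x) \<longlonglongrightarrow> asymp_limit T x"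
proof -
  define q where "q n = (norm ((T ^^ n) x))\<^sup>2" for n
  have "q \<longlonglongrightarrow> (asymp_norm T x)\<^sup>2"
    unfolding q_def by (intro tendsto_intros asymp_norm_tendsto[OF T])
  then have q: "Cauchy q"
    by (rule LIMSEQ_imp_Cauchy)
  have "Cauchy (\<lambda>n. asymp_approx T n x)"
  proof (rule metric_CauchyI)
    fix e :: real assume e: "e > 0"
    obtain N where N: "\<And>m n. m \<ge> N \<Longrightarrow> n \<ge> N \<Longrightarrow> dist (q m) (q n) < e\<^sup>2"
      using metric_CauchyD[OF q, of "e\<^sup>2"] e by auto
    have le: "dist (asymp_approx T n x) (asymp_approx T m x) < e" if "N \<le> n" "n \<le> m" for n m
    proof -
      have "(norm (asymp_approx T n x - asymp_approx T m x))\<^sup>2 \<le> q n - q m"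
        unfolding q_def by (rule norm_asymp_approx_diff[OF T that(2)])
      also have "\<dots> < e\<^sup>2"
        using N[of n m] that by (simp add: dist_real_def)
      finally show ?thesis
        using e by (simp add: dist_norm power2_less_imp_less)
    qed
    then show "\<exists>N. \<forall>m\<ge>N. \<forall>n\<ge>N. dist (asymp_approx T m x) (asymp_approx T n x) < e"
      by (metis dist_commute nat_le_linear)
  qed
  then obtain l where "(\<lambda>n. asymp_approx T n x) \<longlonglongrightarrow> l"
    using Cauchy_convergent_iff convergent_def by blast
  then show ?thesis
    unfolding asymp_limit_def asymp_approx_def by (simp add: limI)
qed

lemma cinner_funpow_tendsto:
  assumes T: "contraction_on UNIV T"
  shows "(\<lambda>n. cinner ((T ^^ n) x) ((T ^^ n) y)) \<longlonglongrightarrow> cinner x (asymp_limit T y)"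
  using tendsto_cinner[OF tendsto_const asymp_approx_tendsto[OF T], of x y]
  by (simp add: asymp_approx_def cinner_adj_funpow[OF T])

lemma asymp_limit_selfadjoint:
  assumes T: "contraction_on UNIV T"
  shows "cinner (asymp_limit T x) y = cinner x (asymp_limit T y)"
proof -
  have "(\<lambda>n. cnj (cinner ((T ^^ n) y) ((T ^^ n) x))) \<longlonglongrightarrow> cnj (cinner y (asymp_limit T x))"
    by (intro tendsto_intros cinner_funpow_tendsto[OF T])
  then show ?thesis
    using cinner_funpow_tendsto[OF T, of x y] LIMSEQ_unique unfolding cinner_commute[symmetric] by blast
qed

lemma Re_cinner_asymp_limit:
  assumes T: "contraction_on UNIV T"
  shows "Re (cinner x (asymp_limit T x)) = (asymp_norm T x)\<^sup>2"
proof -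
  have "(\<lambda>n. (norm ((T ^^ n) x))\<^sup>2) \<longlonglongrightarrow> Re (cinner x (asymp_limit T x))"
    using tendsto_Re[OF cinner_funpow_tendsto[OF T, of x x]] by (simp add: Re_cinner_self)
  moreover have "(\<lambda>n. (norm ((T ^^ n) x))\<^sup>2) \<longlonglongrightarrow> (asymp_norm T x)\<^sup>2"
    by (intro tendsto_intros asymp_norm_tendsto[OF T])
  ultimately show ?thesis
    using LIMSEQ_unique by blast
qed

text \<open>Linearity is read off from self-adjointness, which moves the operator onto the test
  vector.\<close>

lemma contraction_on_asymp_limit:
  assumes T: "contraction_on UNIV T"
  shows "contraction_on UNIV (asymp_limit T)"
proof (rule contraction_onI)
  fix x y :: 'a and a
  show "asymp_limit T (x + y) = asymp_limit T x + asymp_limit T y"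
    by (rule cinner_ext)
      (simp flip: asymp_limit_selfadjoint[OF T] add: cinner_add_right)
  show "asymp_limit T (a *\<^sub>C x) = a *\<^sub>C asymp_limit T x"
    by (rule cinner_ext)
      (simp flip: asymp_limit_selfadjoint[OF T] add: cinner_scaleC_right)
  have "norm (asymp_approx T n x) \<le> norm x" for n
    using norm_asymp_approx_le[OF T, of n x] contraction_onD(5)[OF contraction_on_funpow[OF T], of x n]
    by simp
  then show "norm (asymp_limit T x) \<le> norm x"
    by (intro LIMSEQ_le_const2[OF tendsto_norm[OF asymp_approx_tendsto[OF T]]]) auto
qed auto

text \<open>|T^n x|^2 tends to <x, S x>, and |T*^n T^n x| \<le> |T^n x|. In terms of null orbits the
  kernels of the two asymptotic limits become comparable by Harnack bounds.\<close>

lemma null_space_asymp_limit: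
  assumes T: "contraction_on UNIV T"
  shows "null_space (asymp_limit T) = {x. (\<lambda>n. (T ^^ n) x) \<longlonglongrightarrow> 0}"
proof -
  have "asymp_limit T x = 0 \<longleftrightarrow> (\<lambda>n. (T ^^ n) x) \<longlonglongrightarrow> 0" for x
  proof
    assume "asymp_limit T x = 0"
    then show "(\<lambda>n. (T ^^ n) x) \<longlonglongrightarrow> 0"
      using Re_cinner_asymp_limit[OF T, of x] asymp_norm_eq_0_iff[OF T] by simp
  next
    assume "(\<lambda>n. (T ^^ n) x) \<longlonglongrightarrow> 0"
    then have "(\<lambda>n. asymp_approx T n x) \<longlonglongrightarrow> 0"
      by (rule Lim_null_comparison[OF _ tendsto_norm_zero, rotated]) (simp add: norm_asymp_approx_le[OF T])
    then show "asymp_limit T x = 0"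
      using asymp_approx_tendsto[OF T] LIMSEQ_unique by blast
  qed
  then show ?thesis
    by (auto simp: null_space_def)
qed

section \<open>Orthogonal complements, closed ranges and projections\<close>

definition ortho :: "'a::complex_hilbert set \<Rightarrow> 'a set" where
  "ortho M = {y. \<forall>x\<in>M. cinner x y = 0}"

lemma closed_csubspace_ortho: "closed_csubspace (ortho M)"
proof -
  have "closed (ortho M)"
    unfolding closed_sequential_limits
  proof (intro allI impI, elim conjE)
    fix g l assume g: "\<forall>n. g n \<in> ortho M" "g \<longlonglongrightarrow> l"
    have "cinner x l = 0" if "x \<in> M" for x
      using tendsto_cinner[OF tendsto_const g(2), of x] g(1) that
      by (simp add: ortho_def LIMSEQ_const_iff)
    then show "l \<in> ortho M"
      by (simp add: ortho_def)
  qed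
  then show ?thesis
    by (auto simp: closed_csubspace_def ortho_def cinner_add_right cinner_scaleC_right)
qed

lemma contraction_on_tendsto:
  assumes A: "contraction_on UNIV A" and g: "g \<longlonglongrightarrow> l"
  shows "(\<lambda>n. A (g n)) \<longlonglongrightarrow> A l"
proof (rule LIM_zero_cancel, rule Lim_null_comparison)
  show "(\<lambda>n. norm (g n - l)) \<longlonglongrightarrow> 0"
    using g by (simp add: LIM_zero tendsto_norm_zero)
  show "\<forall>\<^sub>F n in sequentially. norm (A (g n) - A l) \<le> norm (g n - l)"
    by (simp add: contraction_onD(5)[OF A] flip: contraction_on_diff[OF A])
qed

lemma closed_csubspace_null_space:
  assumes A: "contraction_on UNIV A"
  shows "closed_csubspace (null_space A)"
proof -
  have "closed (null_space A)"
    unfolding closed_sequential_limits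
  proof (intro allI impI, elim conjE)
    fix g l assume g: "\<forall>n. g n \<in> null_space A" "g \<longlonglongrightarrow> l"
    then show "l \<in> null_space A"
      using contraction_on_tendsto[OF A g(2)] by (simp add: null_space_def LIMSEQ_const_iff)
  qed
  then show ?thesis
    using contraction_on_zero[OF A]
    by (auto simp: closed_csubspace_def null_space_def contraction_onD[OF A])
qed

lemma closed_csubspace_closure_range:
  assumes A: "contraction_on UNIV A"
  shows "closed_csubspace (closure (range A))"
proof -
  have "x + y \<in> closure (range A)" if xy: "x \<in> closure (range A)" "y \<in> closure (range A)" for x y
  proof -
    obtain f g where f: "\<forall>n. f n \<in> range A" "f \<longlonglongrightarrow> x" and g: "\<forall>n. g n \<in> range A" "g \<longlonglongrightarrow> y"
      using xy unfolding closure_sequential by blast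
    have "A u + A v \<in> range A" for u v
      using contraction_onD(3)[OF A, of u v] by (metis UNIV_I rangeI)
    then have "\<forall>n. f n + g n \<in> range A"
      using f(1) g(1) by (metis imageE)
    with f(2) g(2) show ?thesis
      unfolding closure_sequential by (intro exI[of _ "\<lambda>n. f n + g n"]) (auto intro: tendsto_add)
  qed
  moreover have "a *\<^sub>C x \<in> closure (range A)" if x: "x \<in> closure (range A)" for a x
  proof -
    obtain f where f: "\<forall>n. f n \<in> range A" "f \<longlonglongrightarrow> x"
      using x unfolding closure_sequential by blast
    have "a *\<^sub>C A u \<in> range A" for u
      using contraction_onD(4)[OF A, of u a] by (metis UNIV_I rangeI)
    then have "\<forall>n. a *\<^sub>C f n \<in> range A"
      using f(1) by (metis imageE)
    moreover have "(\<lambda>n. a *\<^sub>C f n) \<longlonglongrightarrow> a *\<^sub>C x"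
    proof (rule LIM_zero_cancel, rule Lim_null_comparison)
      have "a *\<^sub>C f n - a *\<^sub>C x = a *\<^sub>C (f n - x)" for n
        using scaleC_add_right[of a "f n - x" x] by (simp add: algebra_simps)
      then show "\<forall>\<^sub>F n in sequentially. norm (a *\<^sub>C f n - a *\<^sub>C x) \<le> cmod a * norm (f n - x)"
        by (simp add: norm_scaleC)
      show "(\<lambda>n. cmod a * norm (f n - x)) \<longlonglongrightarrow> 0"
        using f(2) by (intro tendsto_mult_right_zero) (simp add: LIM_zero tendsto_norm_zero)
    qed
    ultimately show ?thesis
      unfolding closure_sequential by (intro exI[of _ "\<lambda>n. a *\<^sub>C f n"]) auto
  qed
  moreover have "0 \<in> closure (range A)"
    using contraction_on_zero[OF A] closure_subset by (metis UNIV_I rangeI subsetD)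
  ultimately show ?thesis
    by (simp add: closed_csubspace_def)
qed

lemma closure_range_selfadjoint:
  assumes A: "contraction_on UNIV A" and sa: "\<And>x y. cinner (A x) y = cinner x (A y)"
  shows "closure (range A) = ortho (null_space A)"
proof
  have "range A \<subseteq> ortho (null_space A)"
    by (auto simp: ortho_def null_space_def simp flip: sa)
  then show "closure (range A) \<subseteq> ortho (null_space A)"
    by (rule closure_minimal) (rule closed_csubspaceD(1)[OF closed_csubspace_ortho])
  show "ortho (null_space A) \<subseteq> closure (range A)"
  proof
    fix y assume y: "y \<in> ortho (null_space A)"
    obtain p where p: "p \<in> closure (range A)" "\<And>m. m \<in> closure (range A) \<Longrightarrow> cinner m (y - p) = 0"
      using projection_exists[OF closed_csubspace_closure_range[OF A]] by blast
    \<comment> \<open>y - p is orthogonal to the range, hence in the kernel, hence orthogonal to y;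
      being also orthogonal to p, it is orthogonal to itself.\<close>
    have "cinner x (A (y - p)) = 0" for x
      using p(2)[of "A x"] closure_subset[of "range A"] by (auto simp flip: sa)
    then have "y - p \<in> null_space A"
      using cinner_ext[of "A (y - p)" 0] by (simp add: null_space_def)
    then have "cinner (y - p) y = 0"
      using y by (simp add: ortho_def)
    moreover have "cinner (y - p) p = 0"
      using p by (simp add: cinner_eq_0_commute)
    ultimately have "y - p = 0"
      using cinner_self_eq_0_iff[of "y - p"] by (simp add: cinner_diff_right)
    then show "y \<in> closure (range A)"
      using p(1) by simp
  qed
qed

definition cproj :: "'a::complex_hilbert set \<Rightarrow> 'a \<Rightarrow> 'a" where
  "cproj M x = (SOME p. p \<in> M \<and> x - p \<in> ortho M)"

lemma cproj_in_ortho: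
  assumes M: "closed_csubspace M"
  shows cproj_in: "cproj M x \<in> M" and minus_cproj_in: "x - cproj M x \<in> ortho M"
proof -
  have "\<exists>p. p \<in> M \<and> x - p \<in> ortho M"
    using projection_exists[OF M, of x] by (auto simp: ortho_def)
  then have "cproj M x \<in> M \<and> x - cproj M x \<in> ortho M"
    unfolding cproj_def by (rule someI_ex)
  then show "cproj M x \<in> M" "x - cproj M x \<in> ortho M"
    by auto
qed

lemma ortho_inter: "x \<in> M \<Longrightarrow> x \<in> ortho M \<Longrightarrow> x = 0"
  by (auto simp: ortho_def cinner_self_eq_0_iff)

lemma cproj_eqI:
  assumes M: "closed_csubspace M" and p: "p \<in> M" and q: "x - p \<in> ortho M"
  shows "cproj M x = p"
proof -
  have "cproj M x - p = (x - p) - (x - cproj M x)"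
    by simp
  then have "cproj M x - p \<in> ortho M"
    using closed_csubspaceD(6)[OF closed_csubspace_ortho q minus_cproj_in[OF M, of x]] by simp
  then show ?thesis
    using ortho_inter[of "cproj M x - p" M] closed_csubspaceD(6)[OF M cproj_in[OF M] p] by simp
qed

lemma cproj_add: "closed_csubspace M \<Longrightarrow> cproj M (x + y) = cproj M x + cproj M y"
  using closed_csubspaceD(3)[OF closed_csubspace_ortho minus_cproj_in[of M x] minus_cproj_in[of M y]]
  by (intro cproj_eqI closed_csubspaceD(3)[of M] cproj_in) (auto simp: algebra_simps)

lemma scaleC_diff_right: "a *\<^sub>C (x - y) = a *\<^sub>C x - a *\<^sub>C (y::'a::complex_hilbert)"
  using scaleC_add_right[of a "x - y" y] by (simp add: algebra_simps)

lemma cproj_scaleC: "closed_csubspace M \<Longrightarrow> cproj M (a *\<^sub>C x) = a *\<^sub>C cproj M x"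
  using closed_csubspaceD(4)[OF closed_csubspace_ortho minus_cproj_in[of M x], of a]
  by (intro cproj_eqI closed_csubspaceD(4)[of M] cproj_in) (auto simp: scaleC_diff_right)

lemma norm_orthogonal_sum:
  "p \<in> M \<Longrightarrow> q \<in> ortho M \<Longrightarrow> (norm (p + q))\<^sup>2 = (norm p)\<^sup>2 + (norm q)\<^sup>2"
  by (simp add: norm_add_sq ortho_def)

lemma norm_cproj_sq:
  "closed_csubspace M \<Longrightarrow> (norm x)\<^sup>2 = (norm (cproj M x))\<^sup>2 + (norm (x - cproj M x))\<^sup>2"
  using norm_orthogonal_sum[OF cproj_in[of M x] minus_cproj_in[of M x]] by simp

lemma norm_cproj_le:
  assumes "closed_csubspace M"
  shows "norm (cproj M x) \<le> norm x" "norm (x - cproj M x) \<le> norm x"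
  by (rule power2_le_imp_le; use norm_cproj_sq[OF assms, of x] in simp)+

lemma orthogonal_decomp_ortho:
  assumes M: "closed_csubspace M"
  shows "orthogonal_decomp M (ortho M)"
  unfolding orthogonal_decomp_def
proof (intro conjI allI ballI)
  fix h
  show "\<exists>x\<in>M. \<exists>y\<in>ortho M. h = x + y"
    by (rule bexI[OF _ cproj_in[OF M]], rule bexI[OF _ minus_cproj_in[OF M, of h]]) simp
qed (auto simp: M closed_csubspace_ortho, simp add: ortho_def)

section \<open>Triangulation\<close>

lemma contraction_on_subset:
  assumes T: "contraction_on UNIV T" and inv: "\<And>x. x \<in> M \<Longrightarrow> T x \<in> M"
  shows "contraction_on M T"
  by (rule contraction_onI) (simp_all add: contraction_onD[OF T] inv)

section \<open>Harnack bounds on invariant and reducing subspaces\<close>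

lemma harnack_bound_subset: "harnack_bound M c T T' \<Longrightarrow> N \<subseteq> M \<Longrightarrow> harnack_bound N c T T'"
  unfolding harnack_bound_def by blast

lemma harnack_bound_one_sym:
  assumes hb: "harnack_bound M 1 T T'"
  shows "harnack_bound M 1 T' T"
  unfolding harnack_bound_def
proof (intro allI impI ballI)
  fix a :: "nat \<Rightarrow> complex" and n x
  assume x: "x \<in> M"
  show "Re (\<Sum>i<n. a i * cinner ((T' ^^ i) x) x) \<le> 1 * Re (\<Sum>i<n. a i * cinner ((T ^^ i) x) x)"
  proof (cases n)
    case (Suc k)
    \<comment> \<open>Apply the hypothesis to the polynomial K - p, where K bounds p on the disc.\<close>
    define K where "K = (\<Sum>i<n. cmod (a i))"
    define b where "b i = (if i = 0 then of_real K else 0) - a i" for i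
    have b: "(\<Sum>i<n. b i * g i) = of_real K * g 0 - (\<Sum>i<n. a i * g i)" for g
    proof -
      have "(\<Sum>i<n. b i * g i) = (\<Sum>i<n. (if i = 0 then of_real K * g 0 else 0)) - (\<Sum>i<n. a i * g i)"
        unfolding sum_subtractf[symmetric] by (intro sum.cong) (auto simp: b_def algebra_simps)
      then show ?thesis
        by (simp add: Suc)
    qed
    have "0 \<le> Re (\<Sum>i<n. b i * z ^ i)" if z: "cmod z \<le> 1" for z
    proof -
      have "cmod (\<Sum>i<n. a i * z ^ i) \<le> K"
        unfolding K_def using z
        by (intro sum_norm_le) (simp add: norm_mult norm_power mult_left_le power_le_one)
      then show ?thesis
        unfolding b using complex_Re_le_cmod[of "\<Sum>i<n. a i * z ^ i"] by simp
    qed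
    then have "Re (\<Sum>i<n. b i * cinner ((T ^^ i) x) x) \<le> 1 * Re (\<Sum>i<n. b i * cinner ((T' ^^ i) x) x)"
      using hb[unfolded harnack_bound_def, rule_format, of b n x] x by blast
    then show ?thesis
      unfolding b by simp
  qed simp
qed

text \<open>The forms split along \<open>M\<close> and its complement, and \<open>d\<close> serves
  on \<open>M\<close>. On the complement the operators coincide, but enlarging the constant from 1
  to \<open>d\<close> there requires the form to be nonnegative, an instance of von Neumann's
  inequality; it is extracted from the domination that is already given.\<close>

lemma harnack_bound_direct_sum:
  assumes M: "closed_csubspace M" and T: "contraction_on UNIV T" and T': "contraction_on UNIV T'"
    and inv: "\<And>x. x \<in> M \<Longrightarrow> T x \<in> M" "\<And>x. x \<in> M \<Longrightarrow> T' x \<in> M"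
    and orth: "\<And>y. y \<in> ortho M \<Longrightarrow> T y \<in> ortho M" "\<And>y. y \<in> ortho M \<Longrightarrow> T' y = T y"
    and hb: "harnack_bound UNIV c T T'" "c \<ge> 1" and hb': "harnack_bound M d T' T" "d \<ge> 1"
  shows "\<exists>e\<ge>1. harnack_bound UNIV e T' T"
\<comment> \<open>For c = 1 the domination is a trivial identity on the complement and yields no
  sign, but then \<open>harnack_bound_one_sym\<close> reverses it on the whole space.\<close>
proof (cases "c = 1")
  case True
  then show ?thesis
    using harnack_bound_one_sym hb by blast
next
  case False
  have "harnack_bound UNIV d T' T"
    unfolding harnack_bound_def
  proof (intro allI impI ballI)
    fix a :: "nat \<Rightarrow> complex" and n and x :: 'a
    assume pos: "\<forall>z. cmod z \<le> 1 \<longrightarrow> 0 \<le> Re (\<Sum>i<n. a i * z ^ i)"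
    define m where "m = cproj M x"
    define q where "q = x - m"
    define F where "F V y = Re (\<Sum>i<n. a i * cinner ((V ^^ i) y) y)" for V and y :: 'a
    have m: "m \<in> M" and q: "q \<in> ortho M"
      using cproj_in[OF M] minus_cproj_in[OF M] by (auto simp: m_def q_def)
    have split: "F V x = F V m + F V q"
      if V: "contraction_on UNIV V" and VM: "\<And>x. x \<in> M \<Longrightarrow> V x \<in> M"
        and VN: "\<And>x. x \<in> ortho M \<Longrightarrow> V x \<in> ortho M" for V
    proof -
      have "cinner ((V ^^ i) x) x = cinner ((V ^^ i) m) m + cinner ((V ^^ i) q) q" for i
      proof -
        have Vm: "(V ^^ i) m \<in> M" and Vq: "(V ^^ i) q \<in> ortho M"
          by (induction i) (auto simp: m q VM VN)
        have x: "x = m + q"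
          by (simp add: q_def)
        have "cinner ((V ^^ i) m) q = 0" "cinner ((V ^^ i) q) m = 0"
          using Vm Vq m q by (auto simp: ortho_def cinner_eq_0_commute[of "(V ^^ i) q" m])
        then show ?thesis
          unfolding x by (simp add: contraction_onD(3)[OF contraction_on_funpow[OF V]]
              cinner_add_left cinner_add_right)
      qed
      then show ?thesis
        by (simp add: F_def algebra_simps sum.distrib)
    qed
    have "(T' ^^ i) q = (T ^^ i) q \<and> (T ^^ i) q \<in> ortho M" for i
      by (induction i) (auto simp: q orth)
    then have Fq: "F T' q = F T q"
      by (simp add: F_def)
    \<comment> \<open>T and T' agree on q, so domination reads F T q \<le> c * F T q, and c > 1 makes this
      nonnegativity.\<close>
    have "F T q \<le> c * F T' q"
      using hb(1) pos unfolding harnack_bound_def F_def by blast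
    then have "0 \<le> (c - 1) * F T q"
      by (simp add: Fq algebra_simps)
    then have "0 \<le> F T q"
      using False hb(2) by (simp add: zero_le_mult_iff)
    then have "F T q \<le> d * F T q"
      using hb'(2) mult_right_mono[of 1 d "F T q"] by simp
    moreover have "F T' m \<le> d * F T m"
      using hb'(1) pos m unfolding harnack_bound_def F_def by blast
    ultimately have "F T' x \<le> d * F T x"
      using split[OF T inv(1) orth(1)] split[OF T' inv(2)] orth by (simp add: Fq algebra_simps)
    then show "Re (\<Sum>i<n. a i * cinner ((T' ^^ i) x) x) \<le> d * Re (\<Sum>i<n. a i * cinner ((T ^^ i) x) x)"
      by (simp add: F_def)
  qed
  then show ?thesis
    using hb' by blast
qed

section \<open>Blocks of the triangulation and the idempotent case\<close>

lemma cproj_of_mem: "closed_csubspace M \<Longrightarrow> x \<in> M \<Longrightarrow> cproj M x = x"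
  by (rule cproj_eqI) (auto simp: closed_csubspaceD(2)[OF closed_csubspace_ortho])

lemma cproj_of_ortho: "closed_csubspace M \<Longrightarrow> x \<in> ortho M \<Longrightarrow> cproj M x = 0"
  by (rule cproj_eqI) (auto simp: closed_csubspaceD(2))

lemma contraction_on_compression:
  assumes M: "closed_csubspace M" and T: "contraction_on UNIV T"
  shows "contraction_on (ortho M) (\<lambda>y. T y - cproj M (T y))"
proof (rule contraction_onI)
  fix x y a
  show "T (x + y) - cproj M (T (x + y)) = T x - cproj M (T x) + (T y - cproj M (T y))"
    by (simp add: contraction_onD(3)[OF T] cproj_add[OF M])
  show "T (a *\<^sub>C x) - cproj M (T (a *\<^sub>C x)) = a *\<^sub>C (T x - cproj M (T x))"
    by (simp add: contraction_onD(4)[OF T] cproj_scaleC[OF M] scaleC_diff_right)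
  show "norm (T x - cproj M (T x)) \<le> norm x"
    using norm_cproj_le(2)[OF M, of "T x"] contraction_onD(5)[OF T, of x] by simp
qed (rule minus_cproj_in[OF M])

text \<open>The upper left block can be \<open>T\<close> itself, since only its values on the
  invariant subspace \<open>M\<close> matter.\<close>

lemma block_matrix_triangular:
  assumes M: "closed_csubspace M" and T: "contraction_on UNIV T"
    and inv: "\<And>x. x \<in> M \<Longrightarrow> T x \<in> M"
  shows "block_matrix M (ortho M) T T (\<lambda>y. cproj M (T y)) (\<lambda>x. 0) (\<lambda>y. T y - cproj M (T y))"
proof -
  have "norm (cproj M (T y)) \<le> 1 * norm y" for y
    using norm_cproj_le(1)[OF M, of "T y"] contraction_onD(5)[OF T, of y] by simp
  then have "bounded_clinear_on (ortho M) M (\<lambda>y. cproj M (T y))"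
    unfolding bounded_clinear_on_def
    by (auto simp: cproj_in[OF M] contraction_onD[OF T] cproj_add[OF M] cproj_scaleC[OF M]
        intro!: exI[of _ "1::real"])
  moreover have "bounded_clinear_on M (ortho M) (\<lambda>x. 0)"
    unfolding bounded_clinear_on_def
    by (auto simp: closed_csubspaceD(2)[OF closed_csubspace_ortho] intro!: exI[of _ "0::real"])
  ultimately show ?thesis
    unfolding block_matrix_def
    using orthogonal_decomp_ortho[OF M] contraction_onD(1)[OF contraction_on_subset[OF T inv]]
      contraction_onD(1)[OF contraction_on_compression[OF M T]]
    by (auto simp: contraction_onD(3)[OF T])
qed

lemma null_space_asymp_limit_invariant:
  assumes T: "contraction_on UNIV T" and x: "x \<in> null_space (asymp_limit T)"
  shows "T x \<in> null_space (asymp_limit T)"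
  using x LIMSEQ_Suc[of "\<lambda>n. (T ^^ n) x" 0] unfolding null_space_asymp_limit[OF T]
  by (simp add: funpow_swap1)

lemma ortho_null_space_asymp_limit:
  assumes T: "contraction_on UNIV T"
  shows "closure (range (asymp_limit T)) = ortho (null_space (asymp_limit T))"
  by (rule closure_range_selfadjoint[OF contraction_on_asymp_limit[OF T] asymp_limit_selfadjoint[OF T]])

text \<open>Only a component in \<open>M\<close> is removed, and its orbit is null.\<close>

lemma asymp_norm_compression:
  fixes T :: "'a::complex_hilbert \<Rightarrow> 'a"
  defines "M \<equiv> null_space (asymp_limit T)"
  assumes T: "contraction_on UNIV T"
  shows "asymp_norm T (x - cproj M x) = asymp_norm T x"
proof -
  have "x - (x - cproj M x) \<in> M"
    using cproj_in[OF closed_csubspace_null_space[OF contraction_on_asymp_limit[OF T]], of x]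
    by (simp add: M_def)
  then have "(\<lambda>n. (T ^^ n) (x - (x - cproj M x))) \<longlonglongrightarrow> 0"
    using null_space_asymp_limit[OF T] by (simp add: M_def)
  from asymp_norm_cong[OF T this] show ?thesis
    by simp
qed

text \<open>Applying \<open>T\<close> and removing a component in \<open>M\<close> both preserve
  \<open>asymp_norm T\<close>, so this number is a lower bound for all norms along the orbit of the
  compression; it vanishes only on \<open>M\<close>.\<close>

lemma class_C1_compression:
  fixes T :: "'a::complex_hilbert \<Rightarrow> 'a"
  defines "M \<equiv> null_space (asymp_limit T)"
  assumes T: "contraction_on UNIV T"
  shows "class_C1 (ortho M) (\<lambda>y. T y - cproj M (T y))"
proof -
  define W where "W y = T y - cproj M (T y)" for y
  have M: "closed_csubspace M"
    unfolding M_def by (rule closed_csubspace_null_space[OF contraction_on_asymp_limit[OF T]])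
  have "asymp_norm T ((W ^^ n) y) = asymp_norm T y" for n y
  proof (induction n)
    case (Suc n)
    then show ?case
      using asymp_norm_compression[OF T, of "T ((W ^^ n) y)"] asymp_norm_image[OF T]
      by (simp add: W_def[of "(W ^^ n) y"] M_def)
  qed auto
  then have le: "asymp_norm T y \<le> norm ((W ^^ n) y)" for n y
    using asymp_norm_le_norm[OF T] by metis
  have "y = 0" if y: "y \<in> ortho M" and null: "(\<lambda>n. (W ^^ n) y) \<longlonglongrightarrow> 0" for y
  proof -
    have "asymp_norm T y \<le> 0"
      using le by (intro LIMSEQ_le_const[OF tendsto_norm_zero[OF null]]) auto
    then have "y \<in> M"
      unfolding M_def null_space_asymp_limit[OF T]
      using asymp_norm_nonneg[OF T, of y] asymp_norm_eq_0_iff[OF T, of y] by simp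
    then show ?thesis
      using ortho_inter y by blast
  qed
  then show ?thesis
    unfolding class_C1_def W_def using contraction_on_compression[OF M T] by blast
qed

text \<open>Idempotence puts y - S y into both \<open>M\<close> and its complement, so S y = y and
  the asymptotic norm of y is |y|. The compression preserves the asymptotic norm, hence cannot
  shrink y.\<close>

lemma asymp_limit_idem_imp_isometry:
  fixes T :: "'a::complex_hilbert \<Rightarrow> 'a"
  defines "M \<equiv> null_space (asymp_limit T)"
  assumes T: "contraction_on UNIV T" and idem: "asymp_limit T = asymp_limit T \<circ> asymp_limit T"
    and y: "y \<in> ortho M"
  shows "norm (T y - cproj M (T y)) = norm y"
proof -
  let ?S = "asymp_limit T"
  have M: "closed_csubspace M"
    unfolding M_def by (rule closed_csubspace_null_space[OF contraction_on_asymp_limit[OF T]])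
  have "?S y \<in> ortho M"
    using closure_subset[of "range ?S"] unfolding M_def ortho_null_space_asymp_limit[OF T, symmetric]
    by blast
  then have "y - ?S y \<in> ortho M"
    using y closed_csubspaceD(6)[OF closed_csubspace_ortho] by blast
  moreover have "?S (?S y) = ?S y"
    using idem by (metis comp_apply)
  then have "y - ?S y \<in> M"
    by (simp add: M_def null_space_def contraction_on_diff[OF contraction_on_asymp_limit[OF T]])
  ultimately have "?S y = y"
    using ortho_inter by fastforce
  then have "(asymp_norm T y)\<^sup>2 = (norm y)\<^sup>2"
    using Re_cinner_asymp_limit[OF T, of y] by (simp add: Re_cinner_self)
  then have "norm y = asymp_norm T (T y - cproj M (T y))"
    using asymp_norm_compression[OF T, of "T y"] asymp_norm_image[OF T, of y] asymp_norm_nonneg[OF T, of y]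
    by (simp add: M_def)
  also have "\<dots> \<le> norm (T y - cproj M (T y))"
    by (rule asymp_norm_le_norm[OF T])
  finally have "norm y \<le> norm (T y - cproj M (T y))" .
  then show ?thesis
    using contraction_onD(5)[OF contraction_on_compression[OF M T] y] by simp
qed

lemma compression_isometry_reducing:
  assumes M: "closed_csubspace M" and T: "contraction_on UNIV T"
    and iso: "norm (T y - cproj M (T y)) = norm y"
  shows "cproj M (T y) = 0"
proof -
  have "(norm (T y))\<^sup>2 \<le> (norm y)\<^sup>2"
    by (intro power_mono contraction_onD(5)[OF T]) auto
  then show ?thesis
    using norm_cproj_sq[OF M, of "T y"] iso by simp
qed

text \<open>On the complement \<open>T\<close> is isometric and stays there, so the right side of
  \<open>norm_minus_asymp_approx\<close> is 0 and all approximants fix y. The limit is the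
  projection along \<open>M\<close> and depends on \<open>T\<close> through \<open>M\<close> alone,
  which makes the two asymptotic limits equal.\<close>

lemma asymp_limit_of_isometry:
  fixes T :: "'a::complex_hilbert \<Rightarrow> 'a"
  defines "M \<equiv> null_space (asymp_limit T)"
  assumes T: "contraction_on UNIV T"
    and iso: "\<And>y. y \<in> ortho M \<Longrightarrow> norm (T y - cproj M (T y)) = norm y"
  shows "asymp_limit T = (\<lambda>x. x - cproj M x)"
proof
  fix x
  let ?S = "asymp_limit T"
  note S = contraction_on_asymp_limit[OF T]
  have M: "closed_csubspace M"
    unfolding M_def by (rule closed_csubspace_null_space[OF S])
  define y where "y = x - cproj M x"
  have y: "y \<in> ortho M"
    unfolding y_def by (rule minus_cproj_in[OF M])
  have pow: "(T ^^ n) y \<in> ortho M \<and> norm ((T ^^ n) y) = norm y" for n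
  proof (induction n)
    case (Suc n)
    then have "cproj M (T ((T ^^ n) y)) = 0"
      by (intro compression_isometry_reducing[OF M T] iso) simp
    then show ?case
      using Suc iso[of "(T ^^ n) y"] minus_cproj_in[OF M, of "T ((T ^^ n) y)"] by simp
  qed (simp add: y)
  then have "asymp_approx T n y = y" for n
    using norm_minus_asymp_approx[OF T, of y n] by simp
  then have "?S y = y"
    using asymp_approx_tendsto[OF T, of y] by (simp add: LIMSEQ_const_iff)
  moreover have "?S (cproj M x) = 0"
    using cproj_in[OF M, of x] by (simp add: M_def null_space_def)
  ultimately show "?S x = x - cproj M x"
    using contraction_on_diff[OF S, of x "cproj M x"] by (simp add: y_def)
qed

theorem theorem2p1:
  fixes T T' :: "'a::complex_hilbert \<Rightarrow> 'a"
  assumes "contraction_on UNIV T" and "contraction_on UNIV T'"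
    and "T \<circ> T' = T' \<circ> T"
    and "harnack_dominated_on UNIV T T'"
  shows "null_space (asymp_limit T) = null_space (asymp_limit T') \<and>
    closure (range (asymp_limit T)) = closure (range (asymp_limit T')) \<and>
    (\<exists>Q Q' R R' W. let M = null_space (asymp_limit T); N = closure (range (asymp_limit T)) in
       block_matrix M N T Q R (\<lambda>x. 0) W \<and>
       block_matrix M N T' Q' R' (\<lambda>x. 0) W \<and>
       class_C0 M Q \<and> class_C0 M Q' \<and>
       (\<forall>x\<in>M. Q (Q' x) = Q' (Q x)) \<and>
       harnack_dominated_on M Q Q' \<and>
       class_C1 N W \<and>
       (\<forall>y\<in>N. Q (R' y) - Q' (R y) = R' (W y) - R (W y)) \<and>
       (asymp_limit T = asymp_limit T \<circ> asymp_limit T \<longleftrightarrow>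
          asymp_limit T' = asymp_limit T' \<circ> asymp_limit T') \<and>
       (asymp_limit T = asymp_limit T \<circ> asymp_limit T \<longrightarrow>
          asymp_limit T = asymp_limit T' \<and>
          isometry_on N W \<and>
          (\<forall>y\<in>N. R y = 0 \<and> R' y = 0) \<and>
          (harnack_equivalent_on UNIV T T' \<longleftrightarrow> harnack_dominated_on M Q' Q)))"
proof -
  note T = assms(1) and T' = assms(2)
  have comm: "T (T' x) = T' (T x)" for x
    using assms(3) by (metis comp_apply)
  obtain c where c: "c \<ge> 1" and hb: "harnack_bound UNIV c T T'"
    using assms(4) unfolding harnack_dominated_on_iff[OF closed_csubspace_UNIV] by blast
  define M where "M = null_space (asymp_limit T)"
  have M': "M = null_space (asymp_limit T')"
    unfolding M_def null_space_asymp_limit[OF T] null_space_asymp_limit[OF T']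
    using harnack_null_iff[OF T T' comm hb] c by simp
  have N: "closure (range (asymp_limit T)) = ortho M" "closure (range (asymp_limit T')) = ortho M"
    using ortho_null_space_asymp_limit[OF T] ortho_null_space_asymp_limit[OF T'] M'
    by (simp_all add: M_def)
  have M: "closed_csubspace M"
    unfolding M_def by (rule closed_csubspace_null_space[OF contraction_on_asymp_limit[OF T]])
  have inv: "T x \<in> M" and inv': "T' x \<in> M" if "x \<in> M" for x
    using null_space_asymp_limit_invariant[OF T, of x] null_space_asymp_limit_invariant[OF T', of x] that
    by (simp_all flip: M_def M')
  define W where "W y = T y - cproj M (T y)" for y
  have W': "W y = T' y - cproj M (T' y)" for y
  proof -
    have "T' y - T y \<in> M"
      unfolding M' null_space_asymp_limit[OF T'] using harnack_difference_null[OF T T' comm hb] by simp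
    then have "cproj M (T y + (T' y - T y)) = cproj M (T y) + (T' y - T y)"
      by (simp only: cproj_add[OF M] cproj_of_mem[OF M])
    then show ?thesis
      by (simp add: W_def)
  qed
  define R where "R y = cproj M (T y)" for y
  define R' where "R' y = cproj M (T' y)" for y
  have TW: "T y = R y + W y" "T' y = R' y + W y" for y
    by (simp add: W_def R_def) (simp add: W' R'_def)
  note cM = contraction_on_subset[OF T, of M, OF inv] and cM' = contraction_on_subset[OF T', of M, OF inv']
  have block: "block_matrix M (ortho M) T T R (\<lambda>x. 0) W"
    using block_matrix_triangular[OF M T inv] by (simp add: R_def[abs_def] W_def[abs_def])
  have block': "block_matrix M (ortho M) T' T' R' (\<lambda>x. 0) W"
    using block_matrix_triangular[OF M T' inv'] by (simp add: R'_def[abs_def] W'[abs_def])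
  have C0: "class_C0 M T"
    using cM null_space_asymp_limit[OF T] by (simp add: class_C0_def M_def)
  have C0': "class_C0 M T'"
    using cM' null_space_asymp_limit[OF T'] by (simp add: class_C0_def M')
  have dom: "harnack_dominated_on M T T'"
    unfolding harnack_dominated_on_iff[OF M]
    using cM cM' c harnack_bound_subset[OF hb, of M] by blast
  have C1: "class_C1 (ortho M) W"
    using class_C1_compression[OF T] by (simp add: W_def[abs_def] M_def)
  have rel: "T (R' y) - T' (R y) = R' (W y) - R (W y)" for y
  proof -
    \<comment> \<open>Both sides of \<open>T (T' y) = T' (T y)\<close>, expanded by
      \<open>TW\<close>; a second expansion at \<open>W y\<close> produces \<open>W (W y)\<close> on
      both sides, where it cancels.\<close>
    have "T (R' y) + T (W y) = T' (R y) + T' (W y)"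
      using comm[of y] unfolding TW(1)[of y] TW(2)[of y]
      by (simp add: contraction_onD(3)[OF T] contraction_onD(3)[OF T'])
    then show ?thesis
      unfolding TW(1)[of "W y"] TW(2)[of "W y"] by (simp add: algebra_simps)
  qed
  \<comment> \<open>A condition on the shared corner \<open>W\<close> alone: each idempotence is
    equivalent to it, hence they are equivalent to each other.\<close>
  let ?iso = "\<forall>y\<in>ortho M. norm (W y) = norm y"
  have proj: "(\<lambda>x. x - cproj M x) = (\<lambda>x. x - cproj M x) \<circ> (\<lambda>x. x - cproj M x)"
    using cproj_of_ortho[OF M minus_cproj_in[OF M]] by (simp add: fun_eq_iff)
  have S: "asymp_limit T = (\<lambda>x. x - cproj M x)" if ?iso
    using asymp_limit_of_isometry[OF T] that by (simp add: W_def M_def)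
  have S': "asymp_limit T' = (\<lambda>x. x - cproj M x)" if ?iso
    using asymp_limit_of_isometry[OF T'] that by (simp add: W' M')
  have idem: "asymp_limit T = asymp_limit T \<circ> asymp_limit T \<longleftrightarrow> ?iso"
  proof
    assume "asymp_limit T = asymp_limit T \<circ> asymp_limit T"
    from asymp_limit_idem_imp_isometry[OF T this] show ?iso
      by (simp add: W_def M_def)
  next
    assume ?iso
    show "asymp_limit T = asymp_limit T \<circ> asymp_limit T"
      unfolding S[OF \<open>?iso\<close>] by (rule proj)
  qed
  have idem': "asymp_limit T' = asymp_limit T' \<circ> asymp_limit T' \<longleftrightarrow> ?iso"
  proof
    assume "asymp_limit T' = asymp_limit T' \<circ> asymp_limit T'"
    from asymp_limit_idem_imp_isometry[OF T' this] show ?iso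
      by (simp add: W' M')
  next
    assume ?iso
    show "asymp_limit T' = asymp_limit T' \<circ> asymp_limit T'"
      unfolding S'[OF \<open>?iso\<close>] by (rule proj)
  qed
  have R0: "R y = 0" "R' y = 0" if ?iso "y \<in> ortho M" for y
    using compression_isometry_reducing[OF M T, of y] compression_isometry_reducing[OF M T', of y] that
    by (auto simp: R_def R'_def simp flip: W_def W')
  have isoW: "isometry_on (ortho M) W" if ?iso
    using that C1 by (simp add: isometry_on_def class_C1_def contraction_on_def)
  have equiv: "harnack_equivalent_on UNIV T T' \<longleftrightarrow> harnack_dominated_on M T' T" if iso: ?iso
  proof
    assume "harnack_equivalent_on UNIV T T'"
    then obtain d where "d \<ge> 1" "harnack_bound UNIV d T' T"
      unfolding harnack_equivalent_on_def harnack_dominated_on_iff[OF closed_csubspace_UNIV] by blast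
    then show "harnack_dominated_on M T' T"
      unfolding harnack_dominated_on_iff[OF M] using cM cM' harnack_bound_subset by blast
  next
    assume "harnack_dominated_on M T' T"
    then obtain d where d: "d \<ge> 1" "harnack_bound M d T' T"
      unfolding harnack_dominated_on_iff[OF M] by blast
    have W_in: "W y \<in> ortho M" for y
      unfolding W_def by (rule minus_cproj_in[OF M])
    \<comment> \<open>\<open>R\<close> and \<open>R'\<close> vanish on the complement, so both
      operators act there as \<open>W\<close> and \<open>M\<close> reduces both.\<close>
    have "\<exists>e\<ge>1. harnack_bound UNIV e T' T"
      using R0[OF iso] W_in
      by (intro harnack_bound_direct_sum[OF M T T' inv inv' _ _ hb c d(2,1)]) (auto simp: TW)
    then have "harnack_dominated_on UNIV T' T"
      unfolding harnack_dominated_on_iff[OF closed_csubspace_UNIV] using T T' by blast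
    with assms(4) show "harnack_equivalent_on UNIV T T'"
      by (simp add: harnack_equivalent_on_def)
  qed
  have main: "block_matrix M (ortho M) T T R (\<lambda>x. 0) W \<and>
       block_matrix M (ortho M) T' T' R' (\<lambda>x. 0) W \<and>
       class_C0 M T \<and> class_C0 M T' \<and>
       (\<forall>x\<in>M. T (T' x) = T' (T x)) \<and>
       harnack_dominated_on M T T' \<and>
       class_C1 (ortho M) W \<and>
       (\<forall>y\<in>ortho M. T (R' y) - T' (R y) = R' (W y) - R (W y)) \<and>
       (asymp_limit T = asymp_limit T \<circ> asymp_limit T \<longleftrightarrow>
          asymp_limit T' = asymp_limit T' \<circ> asymp_limit T') \<and>
       (asymp_limit T = asymp_limit T \<circ> asymp_limit T \<longrightarrow>
          asymp_limit T = asymp_limit T' \<and>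
          isometry_on (ortho M) W \<and>
          (\<forall>y\<in>ortho M. R y = 0 \<and> R' y = 0) \<and>
          (harnack_equivalent_on UNIV T T' \<longleftrightarrow> harnack_dominated_on M T' T))"
    unfolding idem idem'
    by (intro conjI impI ballI block block' C0 C0' dom C1 rel comm refl isoW R0 equiv)
      (simp_all add: S S')
  show ?thesis
    unfolding Let_def M_def[symmetric] M'[symmetric] N
    by (rule conjI[OF refl conjI[OF refl]], (rule exI)+, rule main)
qed

end
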